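(* There is an absolute constant $c>0$ such that the following holds. Let $q\ge 2$ and let $\mu$ be a Borel probability measure on $\mathbb R$ with $\beta_q=\int_{\mathbb R}|u|^q\,\mu(du)<\infty$, $m_1=0$, $m_2=1$. Let $X_1,X_2,\dots$ be free random variables, each with distribution $\mu$, and let $F_n$ be the distribution function of $Y_n=(X_1+\dots+X_n)/\sqrt n$. Then, for every $n\in\mathbb N$, $$\sup_{x\in\mathbb R}|F_n(x)-w(x)|\le c\begin{cases}\eta_{q1}(n)\,L_{qn}+n^{-1},&\text{if } 2\le q<3,\\ L_{3n},&\text{if } q\ge 3.\end{cases}$$
   Context: For a probability measure $\mu$ on $\mathbb R$: $m_k=\int u^k\,\mu(du)$ and $\beta_q=\int|u|^q\,\mu(du)$. If $X_1,\dots,X_n$ are free with common distribution $\mu$, the distribution of $X_1+\dots+X_n$ is the $n$-fold free additive convolution $\mu^{n\boxplus}=\mu\boxplus\dots\boxplus\mu$ (defined for arbitrary probability measures on $\mathbb R$, e.g. via additivity of Voiculescu transforms). The distribution of $Y_n$ is denoted $\mu_n$, and $F_n(x)=\mu_n((-\infty,x))=\mu^{n\boxplus}((-\infty,\sqrt n\,x))$. $w(x)$ is the semicircle distribution function, with density $p_w(x)=\frac1{2\pi}\sqrt{(4-x^2)_+}$, where $a_+=\max\{a,0\}$. Lyapunov fractions: $L_{qn}=\beta_q/n^{(q-2)/2}$. Tail moments: $\rho_q(\mu,t)=\int_{|u|>t}|u|^q\,\mu(du)$, $t>0$. With $q_1=\min\{q,3\}$, $$\eta_{q1}(n)=\inf_{0<\varepsilon\le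 10^{-1/2}}\Big(\varepsilon^{3-q_1}+\frac{\rho_{q_1}(\mu,\varepsilon\sqrt n)}{\beta_{q_1}}\varepsilon^{-q_1}\Big).$$ *)

theory Defs
  imports "HOL-Probability.Probability" "HOL-Complex_Analysis.Complex_Analysis"
begin

section \<open>Free additive convolution\<close>

definition cauchy_transform :: "real measure \<Rightarrow> complex \<Rightarrow> complex" where
  "cauchy_transform \<mu> z = (\<integral>u. 1 / (z - complex_of_real u) \<partial>\<mu>)"

definition recip_cauchy_transform :: "real measure \<Rightarrow> complex \<Rightarrow> complex" where
  "recip_cauchy_transform \<mu> z = 1 / cauchy_transform \<mu> z"

definition truncated_cone :: "real \<Rightarrow> real \<Rightarrow> complex set" where
  "truncated_cone \<alpha> \<beta> = {z. Im z > \<beta> \<and> \<bar>Re z\<bar> < \<alpha> * Im z}"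

text \<open>
  The right inverse of the reciprocal Cauchy transform \<open>F\<close> near infinity. In general \<open>F\<close> is not
  injective on the upper half-plane: for \<open>F w = w - 1 / w\<close> (mass 1/2 at each of 1 and -1) a point
  \<open>z\<close> can have the two preimages \<open>w\<close> and \<open>-1 / w\<close> there. The condition \<open>H z / z \<rightarrow> 1\<close> selects the
  branch that inverts \<open>F\<close> on the truncated cones where it is univalent; it determines \<open>H\<close> uniquely
  on the cone. For every \<open>\<mu>\<close> and \<open>\<alpha> > 0\<close> such an \<open>H\<close> exists once \<open>\<beta>\<close> is large enough
  (Bercovici and Voiculescu).
\<close>

definition is_recip_cauchy_inverse ::
  "real measure \<Rightarrow> real \<Rightarrow> real \<Rightarrow> (complex \<Rightarrow> complex) \<Rightarrow> bool" where
  "is_recip_cauchy_inverse \<mu> \<alpha> \<beta> H \<longleftrightarrow>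
     H holomorphic_on truncated_cone \<alpha> \<beta> \<and>
     (\<forall>z\<in>truncated_cone \<alpha> \<beta>. Im (H z) > 0 \<and> recip_cauchy_transform \<mu> (H z) = z) \<and>
     ((\<lambda>z. H z / z) \<longlongrightarrow> 1) (inf at_infinity (principal (truncated_cone \<alpha> \<beta>)))"

definition is_voiculescu_transform ::
  "real measure \<Rightarrow> real \<Rightarrow> real \<Rightarrow> (complex \<Rightarrow> complex) \<Rightarrow> bool" where
  "is_voiculescu_transform \<mu> \<alpha> \<beta> \<phi> \<longleftrightarrow> is_recip_cauchy_inverse \<mu> \<alpha> \<beta> (\<lambda>z. z + \<phi> z)"

text \<open>
  \<open>is_free_convolution I \<mu> \<nu>\<close>: the measure \<open>\<nu>\<close> is the free additive convolution of the finite family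
  \<open>\<mu> i\<close>, \<open>i \<in> I\<close>, i.e. the distribution of a sum of free random variables \<open>X i\<close> with distributions
  \<open>\<mu> i\<close>. No moment or support condition is imposed. The measure \<open>\<nu>\<close> is uniquely determined, since
  a Voiculescu transform on some truncated cone determines the Cauchy transform.
\<close>

definition is_free_convolution ::
  "'i set \<Rightarrow> ('i \<Rightarrow> real measure) \<Rightarrow> real measure \<Rightarrow> bool" where
  "is_free_convolution I \<mu> \<nu> \<longleftrightarrow>
     finite I \<and> (\<forall>i\<in>I. real_distribution (\<mu> i)) \<and> real_distribution \<nu> \<and>
     (\<exists>\<alpha>>0. \<exists>\<beta>>0. \<exists>\<phi> \<psi>.
        (\<forall>i\<in>I. is_voiculescu_transform (\<mu> i) \<alpha> \<beta> (\<phi> i)) \<and>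
        is_voiculescu_transform \<nu> \<alpha> \<beta> \<psi> \<and>
        (\<forall>z\<in>truncated_cone \<alpha> \<beta>. \<psi> z = (\<Sum>i\<in>I. \<phi> i z)))"

definition is_free_convolution_power :: "nat \<Rightarrow> real measure \<Rightarrow> real measure \<Rightarrow> bool" where
  "is_free_convolution_power n \<mu> \<nu> \<longleftrightarrow> is_free_convolution {1..n} (\<lambda>_. \<mu>) \<nu>"


section \<open>Distribution functions\<close>

text \<open>The left-continuous convention, unlike \<^const>\<open>cdf\<close>.\<close>

definition distr_fun :: "real measure \<Rightarrow> real \<Rightarrow> real" where
  "distr_fun \<mu> x = measure \<mu> {..<x}"

definition semicircle_density :: "real \<Rightarrow> real" where
  "semicircle_density x = 1 / (2 * pi) * sqrt (max (4 - x\<^sup>2) 0)"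

definition semicircle :: "real measure" where
  "semicircle = density lborel (\<lambda>x. ennreal (semicircle_density x))"

text \<open>If \<open>\<nu>\<close> is the distribution of \<open>X\<^sub>1 + \<dots> + X\<^sub>n\<close>, this is the distribution of the sum
  divided by \<open>sqrt n\<close>.\<close>

definition normalized_law :: "nat \<Rightarrow> real measure \<Rightarrow> real measure" where
  "normalized_law n \<nu> = distr \<nu> borel (\<lambda>u. u / sqrt (real n))"


section \<open>Moments and Lyapunov fractions\<close>

definition abs_moment :: "real measure \<Rightarrow> real \<Rightarrow> real" where
  "abs_moment \<mu> q = (\<integral>u. \<bar>u\<bar> powr q \<partial>\<mu>)"

definition tail_moment :: "real measure \<Rightarrow> real \<Rightarrow> real \<Rightarrow> real" where
  "tail_moment \<mu> q t = (LINT u:{u. \<bar>u\<bar> > t}|\<mu>. \<bar>u\<bar> powr q)"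

definition lyapunov_fraction :: "real measure \<Rightarrow> real \<Rightarrow> nat \<Rightarrow> real" where
  "lyapunov_fraction \<mu> q n = abs_moment \<mu> q / real n powr ((q - 2) / 2)"

definition eta1 :: "real measure \<Rightarrow> real \<Rightarrow> nat \<Rightarrow> real" where
  "eta1 \<mu> q n = (let q1 = min q 3 in
     INF \<epsilon>\<in>{0<..10 powr (- 1 / 2)}.
       \<epsilon> powr (3 - q1)
       + tail_moment \<mu> q1 (\<epsilon> * sqrt (real n)) / abs_moment \<mu> q1 * \<epsilon> powr (- q1))"

end

theory Submission
  imports Defs
begin

text \<open>
  Let \<open>M\<close> be the law of \<open>X / sqrt n\<close> with reciprocal Cauchy transform \<open>F\<close>, and \<open>N z = z - F z\<close>.
  For \<open>z\<close> in the upper half-plane the equation \<open>Z + (n - 1) N Z = z\<close> has exactly one solution \<open>Z\<close>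
  there (Brouwer, and a Pick-type inequality for \<open>N\<close>), and the reciprocal Cauchy transform of the law
  \<open>\<nu>\<close> of the normalized sum is \<open>F Z\<close> at \<open>z\<close>. Integrating this along horizontal lines gives an exact
  formula for \<open>A\<^sub>\<nu> z = (\<integral>u. arg (z - u) \<partial>\<nu>)\<close>, the Poisson-smoothed tail of \<open>\<nu>\<close>:
  \<open>A\<^sub>\<nu> z = n A\<^sub>M Z - (n - 1) arg (F Z)\<close>.

  With \<open>\<delta> = E (X\<^sup>2 min (\<bar>X\<bar> / sqrt n) 1)\<close> and \<open>z = 2 cos \<theta> + i y\<close>, the solution satisfies
  \<open>Z = exp (i \<theta>) + O(\<delta> / sin\<^sup>2 \<theta>)\<close> as long as \<open>sin\<^sup>3 \<theta>\<close> is at least a multiple of \<open>\<delta>\<close>. Up to \<open>O(\<delta>)\<close>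
  the formula expresses \<open>A\<^sub>\<nu> z\<close> by a function of \<open>Z\<close> that is stationary at \<open>exp (i \<theta>)\<close> with
  second derivative of order \<open>sin \<theta>\<close>, so the error in \<open>Z\<close> only costs \<open>O(\<delta>\<^sup>2 / sin\<^sup>3 \<theta>) = O(\<delta>)\<close>. Large
  jumps need no truncation because arguments are bounded. The excluded \<open>\<theta>\<close> carry semicircle mass
  \<open>O(\<delta>)\<close>, hence the Kolmogorov distance is \<open>O(\<delta>)\<close>; and \<open>\<delta>\<close> is pointwise dominated by the two
  right-hand sides.
\<close>

section \<open>Cauchy transforms and argument potentials\<close>

lemma has_derivative_of_quadratic_error:
  fixes f :: "'a::real_normed_vector \<Rightarrow> 'b::real_normed_vector"
  assumes "bounded_linear D" "r > 0"
    and err: "\<And>h. norm h < r \<Longrightarrow> norm (f (z + h) - f z - D h) \<le> C * (norm h)\<^sup>2"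
  shows "(f has_derivative D) (at z)"
  unfolding has_derivative_at
proof (intro conjI assms)
  show "(\<lambda>h. norm (f (z + h) - f z - D h) / norm h) \<midarrow>0\<rightarrow> 0"
  proof (rule tendsto_sandwich[where f = "\<lambda>_. 0" and h = "\<lambda>h. C * norm h"])
    show "\<forall>\<^sub>F h in at 0. norm (f (z + h) - f z - D h) / norm h \<le> C * norm h"
      unfolding eventually_at using \<open>r > 0\<close>
    proof (intro exI[of _ r] conjI ballI impI)
      fix h :: 'a assume "h \<noteq> 0 \<and> dist h 0 < r"
      then show "norm (f (z + h) - f z - D h) / norm h \<le> C * norm h"
        using err[of h] by (simp add: divide_le_eq power2_eq_square mult.assoc)
    qed
    show "(\<lambda>h::'a. C * norm h) \<midarrow>0\<rightarrow> 0"
      by (auto intro!: tendsto_eq_intros)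
  qed auto
qed

text \<open>Both arguments lie strictly between 0 and pi, so their difference stays in the range of
  the principal branch.\<close>

lemma Ln_divide_upper:
  assumes "Im a > 0" "Im b > 0"
  shows "Ln (b / a) = Ln b - Ln a"
proof -
  have "a \<noteq> 0" "b \<noteq> 0" using assms by auto
  then have "exp (Ln b - Ln a) = b / a"
    by (simp add: exp_diff)
  moreover have "- pi < Im (Ln b - Ln a)" "Im (Ln b - Ln a) \<le> pi"
    using Im_Ln_pos_lt_imp[OF assms(1)] Im_Ln_pos_lt_imp[OF assms(2)] by auto
  ultimately show ?thesis
    by (metis Ln_exp)
qed

lemma Im_le_norm_diff_of_real: "Im z \<le> cmod (z - of_real u)"
  using abs_Im_le_cmod[of "z - of_real u"] by simp

lemma diff_of_real_nonzero: "Im z > 0 \<Longrightarrow> z - of_real u \<noteq> 0"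
  using Im_le_norm_diff_of_real[of z u] by auto

lemma norm_resolvent_le: "Im z > 0 \<Longrightarrow> cmod (1 / (z - of_real u)) \<le> 1 / Im z"
  by (simp add: norm_divide frac_le Im_le_norm_diff_of_real)

text \<open>The imaginary part of the logarithmic potential. In the upper half-plane its integrand
  lies between 0 and pi, so it is finite for every law; its boundary values encode the upper tail of
  \<open>M\<close>.\<close>

definition arg_potential :: "real measure \<Rightarrow> complex \<Rightarrow> real" where
  "arg_potential M z = (\<integral>u. Im (Ln (z - complex_of_real u)) \<partial>M)"

abbreviation upper_half_plane :: "complex set" where
  "upper_half_plane \<equiv> {z. Im z > 0}"

lemma open_upper_half_plane: "open upper_half_plane"
  by (simp add: open_halfspace_Im_gt)

lemma convex_upper_half_plane: "convex upper_half_plane"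
  by (simp add: convex_halfspace_Im_gt)

section \<open>Analytic properties of the Cauchy transform and of the argument potential\<close>

context real_distribution
begin

lemma integrable_resolvent:
  assumes "Im z > 0"
  shows "integrable M (\<lambda>u. 1 / (z - complex_of_real u))"
  by (rule integrable_const_bound[of _ "1 / Im z"]) (auto intro: norm_resolvent_le[OF assms])

lemma integrable_resolvent_mult:
  assumes "Im z > 0" "Im w > 0"
  shows "integrable M (\<lambda>u. 1 / (z - complex_of_real u) * (1 / (w - complex_of_real u)))"
proof (rule integrable_const_bound[of _ "1 / Im z * (1 / Im w)"])
  show "AE u in M. cmod (1 / (z - complex_of_real u) * (1 / (w - complex_of_real u))) \<le> 1 / Im z * (1 / Im w)"
    unfolding norm_mult using norm_resolvent_le[OF assms(1)] norm_resolvent_le[OF assms(2)] assms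
    by (intro AE_I2 mult_mono) auto
qed measurable

lemma integrable_norm_resolvent_sq:
  assumes "Im z > 0"
  shows "integrable M (\<lambda>u. (cmod (1 / (z - complex_of_real u)))\<^sup>2)"
proof -
  have "integrable M (\<lambda>u. cmod (1 / (z - complex_of_real u) * (1 / (z - complex_of_real u))))"
    using integrable_resolvent_mult[OF assms assms] by (rule integrable_norm)
  then show ?thesis by (simp only: norm_mult power2_eq_square)
qed

lemma resolvent_identity:
  assumes "Im z > 0" "Im w > 0"
  shows "cauchy_transform M z - cauchy_transform M w
    = (w - z) * (\<integral>u. 1 / (z - complex_of_real u) * (1 / (w - complex_of_real u)) \<partial>M)"
proof -
  have "cauchy_transform M z - cauchy_transform M w
     = (\<integral>u. 1 / (z - complex_of_real u) - 1 / (w - complex_of_real u) \<partial>M)"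
    unfolding cauchy_transform_def
    by (rule Bochner_Integration.integral_diff[symmetric]) (intro integrable_resolvent assms)+
  also have "\<dots> = (\<integral>u. (w - z) * (1 / (z - complex_of_real u) * (1 / (w - complex_of_real u))) \<partial>M)"
    using diff_of_real_nonzero[OF assms(1)] diff_of_real_nonzero[OF assms(2)]
    by (intro Bochner_Integration.integral_cong refl) (simp add: divide_simps)
  finally show ?thesis by (simp only: integral_mult_right_zero)
qed

text \<open>Subtracting resolvents twice turns the first-order remainder into
  \<open>h\<^sup>2\<close> times an integral of three resolvents.\<close>

lemma cauchy_transform_has_field_derivative:
  assumes "Im z > 0"
  shows "\<exists>D. (cauchy_transform M has_field_derivative D) (at z)"
proof -
  define D where "D = (\<integral>u. 1 / (z - complex_of_real u) * (1 / (z - complex_of_real u)) \<partial>M)"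
  have "(cauchy_transform M has_derivative (*) (- D)) (at z)"
  \<comment> \<open>For \<open>cmod h < Im z / 2\<close> the point \<open>z + h\<close> keeps height
    at least \<open>Im z / 2\<close>, so the product of three resolvents is at most
    \<open>2 / Im z ^ 3\<close>.\<close>
  proof (rule has_derivative_of_quadratic_error[where r = "Im z / 2" and C = "2 / Im z ^ 3"])
    fix h assume h: "cmod h < Im z / 2"
    have zh: "Im z / 2 \<le> Im (z + h)" "Im (z + h) > 0"
      using h abs_Im_le_cmod[of h] assms by auto
    have "cauchy_transform M (z + h) - cauchy_transform M z - - D * h
        = - h * ((\<integral>u. 1 / (z + h - complex_of_real u) * (1 / (z - complex_of_real u)) \<partial>M) - D)"
      by (subst resolvent_identity[OF zh(2) assms]) (simp add: algebra_simps)
    also have "(\<integral>u. 1 / (z + h - complex_of_real u) * (1 / (z - complex_of_real u)) \<partial>M) - D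
       = (\<integral>u. (1 / (z + h - complex_of_real u) - 1 / (z - complex_of_real u)) * (1 / (z - complex_of_real u)) \<partial>M)"
      unfolding D_def left_diff_distrib
      by (rule Bochner_Integration.integral_diff[symmetric]) (intro integrable_resolvent_mult assms zh)+
    also have "\<dots> = (\<integral>u. - h * (1 / (z + h - complex_of_real u) * (1 / (z - complex_of_real u)) * (1 / (z - complex_of_real u))) \<partial>M)"
      using diff_of_real_nonzero[OF assms(1)] diff_of_real_nonzero[OF zh(2)]
      by (intro Bochner_Integration.integral_cong refl) (simp add: divide_simps algebra_simps)
    also have "\<dots> = - h * (\<integral>u. 1 / (z + h - complex_of_real u) * (1 / (z - complex_of_real u)) * (1 / (z - complex_of_real u)) \<partial>M)"
      by (rule integral_mult_right_zero)
    finally have eq: "cmod (cauchy_transform M (z + h) - cauchy_transform M z - - D * h)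
      = (cmod h)\<^sup>2 * cmod (\<integral>u. 1 / (z + h - complex_of_real u) * (1 / (z - complex_of_real u)) * (1 / (z - complex_of_real u)) \<partial>M)"
      by (simp add: norm_mult power2_eq_square)
    have "cmod (\<integral>u. 1 / (z + h - complex_of_real u) * (1 / (z - complex_of_real u)) * (1 / (z - complex_of_real u)) \<partial>M)
       \<le> (\<integral>u. cmod (1 / (z + h - complex_of_real u) * (1 / (z - complex_of_real u)) * (1 / (z - complex_of_real u))) \<partial>M)"
      by (rule integral_norm_bound)
    also have "\<dots> \<le> 1 / (Im z / 2) * (1 / Im z) * (1 / Im z)"
    proof (rule integral_le_const)
      have b: "cmod (1 / (z + h - complex_of_real u) * (1 / (z - complex_of_real u)) * (1 / (z - complex_of_real u)))
          \<le> 1 / (Im z / 2) * (1 / Im z) * (1 / Im z)" for u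
      proof -
        have "cmod (1 / (z + h - complex_of_real u)) \<le> 1 / (Im z / 2)"
          by (rule order_trans[OF norm_resolvent_le[OF zh(2)]]) (intro frac_le zh, use assms in auto)
        then show ?thesis
          unfolding norm_mult using norm_resolvent_le[OF assms, of u] assms
          by (intro mult_mono) auto
      qed
      show "AE u in M. cmod (1 / (z + h - complex_of_real u) * (1 / (z - complex_of_real u)) * (1 / (z - complex_of_real u)))
          \<le> 1 / (Im z / 2) * (1 / Im z) * (1 / Im z)" using b by simp
      show "integrable M (\<lambda>u. cmod (1 / (z + h - complex_of_real u) * (1 / (z - complex_of_real u)) * (1 / (z - complex_of_real u))))"
        by (intro integrable_norm integrable_const_bound[OF AE_I2[OF b]]) measurable
    qed
    finally show "cmod (cauchy_transform M (z + h) - cauchy_transform M z - - D * h) \<le> 2 / Im z ^ 3 * (cmod h)\<^sup>2"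
      unfolding eq by (rule order_trans[OF mult_left_mono]) (auto simp: power3_eq_cube mult.commute)
  qed (use assms in \<open>auto intro: bounded_linear_mult_right\<close>)
  then show ?thesis by (auto simp: has_field_derivative_def)
qed

lemma cauchy_transform_holomorphic: "cauchy_transform M holomorphic_on upper_half_plane"
  using cauchy_transform_has_field_derivative by (simp add: holomorphic_on_open open_upper_half_plane)

lemma Im_cauchy_transform:
  assumes "Im z > 0"
  shows "Im (cauchy_transform M z) = - Im z * (\<integral>u. (cmod (1 / (z - complex_of_real u)))\<^sup>2 \<partial>M)"
proof -
  have "Im (cauchy_transform M z) = (\<integral>u. Im (1 / (z - complex_of_real u)) \<partial>M)"
    unfolding cauchy_transform_def by (rule integral_Im[symmetric, OF integrable_resolvent[OF assms]])
  also have "\<dots> = (\<integral>u. - Im z * (cmod (1 / (z - complex_of_real u)))\<^sup>2 \<partial>M)"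
    by (intro Bochner_Integration.integral_cong refl)
       (simp add: Im_divide cmod_power2 norm_divide power_divide)
  finally show ?thesis by simp
qed

lemma Im_cauchy_transform_neg:
  assumes "Im z > 0"
  shows "Im (cauchy_transform M z) < 0"
proof -
  have "(\<integral>u. (cmod (1 / (z - complex_of_real u)))\<^sup>2 \<partial>M) \<noteq> 0"
  proof
    assume "(\<integral>u. (cmod (1 / (z - complex_of_real u)))\<^sup>2 \<partial>M) = 0"
    then have "AE u in M. (cmod (1 / (z - complex_of_real u)))\<^sup>2 = 0"
      by (subst (asm) integral_nonneg_eq_0_iff_AE[OF integrable_norm_resolvent_sq[OF assms]]) auto
    then have "AE u in M. False"
      by eventually_elim (use diff_of_real_nonzero[OF assms] in auto)
    then show False by simp
  qed
  then have "(\<integral>u. (cmod (1 / (z - complex_of_real u)))\<^sup>2 \<partial>M) > 0"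
    by (simp add: less_le)
  then show ?thesis
    unfolding Im_cauchy_transform[OF assms] using assms by simp
qed

lemma cauchy_transform_nonzero: "Im z > 0 \<Longrightarrow> cauchy_transform M z \<noteq> 0"
  using Im_cauchy_transform_neg by fastforce

lemma recip_cauchy_transform_holomorphic: "recip_cauchy_transform M holomorphic_on upper_half_plane"
  unfolding recip_cauchy_transform_def[abs_def]
  using cauchy_transform_nonzero by (intro holomorphic_intros cauchy_transform_holomorphic) auto

lemma Im_Ln_bounds:
  assumes "Im z > 0"
  shows "0 < Im (Ln (z - complex_of_real u))" "Im (Ln (z - complex_of_real u)) < pi"
  using Im_Ln_pos_lt_imp[of "z - complex_of_real u"] assms by auto

lemma integrable_Im_Ln:
  assumes "Im z > 0"
  shows "integrable M (\<lambda>u. Im (Ln (z - complex_of_real u)))"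
  by (rule integrable_const_bound[of _ pi])
     (use Im_Ln_bounds[OF assms] in \<open>auto simp: abs_le_iff less_imp_le intro: order_trans[of _ 0]\<close>)

text \<open>For each \<open>u\<close> the increment of the logarithm is \<open>Ln (1 + w)\<close>
  with \<open>w = h / (z - u)\<close> and \<open>cmod w \<le> 1 / 2\<close>, and
  \<open>Ln (1 + w) - w\<close> is quadratic in \<open>w\<close>. The linear part integrates to the
  Cauchy transform.\<close>

lemma arg_potential_has_derivative:
  assumes "Im z > 0"
  shows "(arg_potential M has_derivative (\<lambda>h. Im (cauchy_transform M z * h))) (at z)"
proof (rule has_derivative_of_quadratic_error[where r = "Im z / 2" and C = "2 / (Im z)\<^sup>2"])
  show "bounded_linear (\<lambda>h. Im (cauchy_transform M z * h))"
    by (intro bounded_linear_compose[OF bounded_linear_Im] bounded_linear_mult_right)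
  fix h assume h: "cmod h < Im z / 2"
  have zh: "Im (z + h) > 0"
    using h abs_Im_le_cmod[of h] assms by auto
  let ?r = "\<lambda>u. Im (Ln (z + h - complex_of_real u)) - Im (Ln (z - complex_of_real u)) - Im (1 / (z - complex_of_real u) * h)"
  have int: "integrable M ?r"
    by (intro Bochner_Integration.integrable_diff integrable_Im_Ln integrable_Im
        integrable_mult_left integrable_resolvent assms zh)
  have eq: "arg_potential M (z + h) - arg_potential M z - Im (cauchy_transform M z * h) = (\<integral>u. ?r u \<partial>M)"
  proof -
    have "Im (cauchy_transform M z * h) = Im (\<integral>u. 1 / (z - complex_of_real u) * h \<partial>M)"
      unfolding cauchy_transform_def by (simp only: integral_mult_left_zero)
    also have "\<dots> = (\<integral>u. Im (1 / (z - complex_of_real u) * h) \<partial>M)"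
      by (intro integral_Im[symmetric] integrable_mult_left integrable_resolvent assms)
    finally have "Im (cauchy_transform M z * h) = (\<integral>u. Im (1 / (z - complex_of_real u) * h) \<partial>M)" .
    moreover have "integrable M (\<lambda>u. Im (1 / (z - complex_of_real u) * h))"
      by (intro integrable_Im integrable_mult_left integrable_resolvent assms)
    ultimately show ?thesis
      unfolding arg_potential_def using integrable_Im_Ln[OF assms] integrable_Im_Ln[OF zh]
      by (simp only: Bochner_Integration.integral_diff Bochner_Integration.integrable_diff)
  qed
  have "norm (\<integral>u. ?r u \<partial>M) \<le> (\<integral>u. norm (?r u) \<partial>M)"
    by (rule integral_norm_bound)
  also have "\<dots> \<le> 2 / (Im z)\<^sup>2 * (cmod h)\<^sup>2"
  proof (rule integral_le_const[OF integrable_norm[OF int]], intro AE_I2)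
    fix u
    define w where "w = h / (z - complex_of_real u)"
    have nz: "z - complex_of_real u \<noteq> 0" using assms by (rule diff_of_real_nonzero)
    have "cmod w = cmod h * cmod (1 / (z - complex_of_real u))"
      by (simp add: w_def norm_divide)
    also have "\<dots> \<le> cmod h * (1 / Im z)"
      by (intro mult_left_mono norm_resolvent_le assms) auto
    finally have wh: "cmod w \<le> cmod h / Im z" by simp
    also have "\<dots> \<le> 1 / 2" using h assms by (simp add: divide_simps)
    finally have w: "cmod w \<le> 1 / 2" .
    have "Ln (z + h - complex_of_real u) - Ln (z - complex_of_real u) = Ln ((z + h - complex_of_real u) / (z - complex_of_real u))"
      using zh assms by (intro Ln_divide_upper[symmetric]) auto
    also have "(z + h - complex_of_real u) / (z - complex_of_real u) = 1 + w"
      using nz by (simp add: w_def field_simps)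
    finally have "?r u = Im (Ln (1 + w) - w)"
      by (simp add: w_def flip: minus_complex.simps(2))
    also have "norm \<dots> \<le> cmod (Ln (1 + w) - w)"
      by (simp only: real_norm_def abs_Im_le_cmod)
    also have "\<dots> \<le> (cmod w)\<^sup>2 / (1 - cmod w)"
      using w by (intro Ln_approx_linear) auto
    also have "\<dots> \<le> (cmod w)\<^sup>2 / (1 / 2)"
      using w by (intro divide_left_mono) auto
    also have "\<dots> \<le> 2 * (cmod h / Im z)\<^sup>2"
      using power_mono[OF wh, of 2] by simp
    finally show "norm (?r u) \<le> 2 / (Im z)\<^sup>2 * (cmod h)\<^sup>2"
      by (simp add: power_divide)
  qed
  finally show "norm (arg_potential M (z + h) - arg_potential M z - Im (cauchy_transform M z * h))
    \<le> 2 / (Im z)\<^sup>2 * (cmod h)\<^sup>2"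
    unfolding eq .
qed (use assms in auto)

end

section \<open>Reciprocal Cauchy transforms of centered laws\<close>

locale centered_distribution = real_distribution +
  assumes integrable_square: "integrable M (\<lambda>u. u\<^sup>2)"
    and expectation_zero: "(\<integral>u. u \<partial>M) = 0"
begin

definition F :: "complex \<Rightarrow> complex" where "F = recip_cauchy_transform M"

definition N :: "complex \<Rightarrow> complex" where "N z = z - F z"

text \<open>
  \<open>k\<^sub>z u = F z / (z - u) - 1\<close> has mean zero, and \<open>\<integral>k\<^sub>z k\<^sub>w = (F z - F w) / (z - w) - 1\<close>. So Cauchy-Schwarz
  for the \<open>k\<^sub>z\<close> yields the Pick inequality for \<open>N\<close> without its Nevanlinna representation.
\<close>

definition variance_F :: "complex \<Rightarrow> real" where
  "variance_F z = (\<integral>u. (cmod (F z / (z - complex_of_real u) - 1))\<^sup>2 \<partial>M)"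

lemma integrable_ident: "integrable M (\<lambda>u. u)"
proof (rule Bochner_Integration.integrable_bound[of M "\<lambda>u. 1 + u\<^sup>2"])
  show "AE u in M. norm u \<le> norm (1 + u\<^sup>2)"
  proof (intro AE_I2)
    fix u :: real
    have "0 \<le> (\<bar>u\<bar> - 1)\<^sup>2" by simp
    then show "norm u \<le> norm (1 + u\<^sup>2)" by (simp add: power2_diff)
  qed
qed (use integrable_square in auto)

lemma F_nonzero: "Im z > 0 \<Longrightarrow> F z \<noteq> 0"
  by (simp add: F_def recip_cauchy_transform_def cauchy_transform_nonzero)

lemma cauchy_transform_eq: "cauchy_transform M z = 1 / F z"
  by (simp add: F_def recip_cauchy_transform_def)

lemma F_holomorphic: "F holomorphic_on upper_half_plane"
  unfolding F_def by (rule recip_cauchy_transform_holomorphic)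

lemma N_holomorphic: "N holomorphic_on upper_half_plane"
  unfolding N_def[abs_def] by (intro holomorphic_intros F_holomorphic)

lemma integral_resolvent: "(\<integral>u. 1 / (z - complex_of_real u) \<partial>M) = 1 / F z"
  using cauchy_transform_eq by (simp add: cauchy_transform_def)

text \<open>Expand the square: \<open>F z / (z - u)\<close> has mean 1, and the mean of the squared
  resolvent is read off from \<open>Im_cauchy_transform\<close>. Nonnegativity of a variance thus
  says that \<open>N\<close> maps the upper half-plane into the closed lower one.\<close>

lemma fluctuation_norm_sq:
  assumes "Im z > 0"
  shows "integrable M (\<lambda>u. (cmod (F z / (z - complex_of_real u) - 1))\<^sup>2)"
    and "variance_F z = - Im (N z) / Im z"
proof -
  let ?r = "\<lambda>u. 1 / (z - complex_of_real u)"
  have eq: "(cmod (F z / (z - complex_of_real u) - 1))\<^sup>2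
      = (cmod (F z))\<^sup>2 * (cmod (?r u))\<^sup>2 - 2 * Re (F z * ?r u) + 1" for u
  proof -
    have "(cmod (a - 1))\<^sup>2 = (cmod a)\<^sup>2 - 2 * Re a + 1" for a
      by (simp add: cmod_power2 power2_diff)
    from this[of "F z * ?r u"] show ?thesis
      by (simp add: norm_divide power_divide)
  qed
  have i1: "integrable M (\<lambda>u. (cmod (F z))\<^sup>2 * (cmod (?r u))\<^sup>2)"
    by (intro integrable_mult_right integrable_norm_resolvent_sq assms)
  have i2: "integrable M (\<lambda>u. 2 * Re (F z * ?r u))"
    by (intro integrable_mult_right integrable_Re integrable_resolvent assms)
  show "integrable M (\<lambda>u. (cmod (F z / (z - complex_of_real u) - 1))\<^sup>2)"
    unfolding eq by (intro Bochner_Integration.integrable_add Bochner_Integration.integrable_diff i1 i2) simp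
  have "variance_F z = (\<integral>u. (cmod (F z))\<^sup>2 * (cmod (?r u))\<^sup>2 \<partial>M) - (\<integral>u. 2 * Re (F z * ?r u) \<partial>M) + 1"
    unfolding variance_F_def eq using i1 i2
    by (simp only: Bochner_Integration.integral_add Bochner_Integration.integral_diff
        Bochner_Integration.integrable_diff integrable_const prob_space lebesgue_integral_const scaleR_one)
  also have "(\<integral>u. (cmod (F z))\<^sup>2 * (cmod (?r u))\<^sup>2 \<partial>M) = (cmod (F z))\<^sup>2 * (- Im (cauchy_transform M z) / Im z)"
    using assms by (simp only: integral_mult_right_zero Im_cauchy_transform) simp
  also have "\<dots> = Im (F z) / Im z"
  proof -
    have "(cmod (F z))\<^sup>2 \<noteq> 0"
      using F_nonzero[OF assms] by simp
    moreover have "Im (cauchy_transform M z) = - Im (F z) / (cmod (F z))\<^sup>2"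
      by (simp add: cauchy_transform_eq Im_divide cmod_power2)
    ultimately show ?thesis by simp
  qed
  also have "(\<integral>u. 2 * Re (F z * ?r u) \<partial>M) = 2 * Re (F z * (\<integral>u. ?r u \<partial>M))"
    using integral_Re[OF integrable_mult_right[OF integrable_resolvent[OF assms], of "F z"]]
    by (simp only: integral_mult_right_zero)
  also have "\<dots> = 2"
    using F_nonzero[OF assms] by (simp add: integral_resolvent)
  finally show "variance_F z = - Im (N z) / Im z"
    using assms by (simp add: N_def field_simps)
qed

lemma variance_F_nonneg: "variance_F z \<ge> 0"
  unfolding variance_F_def by (rule Bochner_Integration.integral_nonneg) simp

lemma Im_N_nonpos: "Im z > 0 \<Longrightarrow> Im (N z) \<le> 0"
  using variance_F_nonneg[of z] fluctuation_norm_sq(2)[of z] by (simp add: divide_le_0_iff)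

lemma Im_F_ge: "Im z > 0 \<Longrightarrow> Im (F z) \<ge> Im z"
  using Im_N_nonpos[of z] by (simp add: N_def)

text \<open>The integral of \<open>?k z u * ?k w u\<close> is minus the difference quotient of
  \<open>N\<close>. The arithmetic mean of the variances stands in for the geometric mean; this
  suffices because it is applied to two variances below a common threshold.\<close>

lemma norm_N_diff_le:
  assumes z: "Im z > 0" and w: "Im w > 0"
  shows "cmod (N z - N w) \<le> cmod (z - w) * ((variance_F z + variance_F w) / 2)"
proof -
  let ?k = "\<lambda>z u. F z / (z - complex_of_real u) - 1"
  let ?r = "\<lambda>z u. 1 / (z - complex_of_real u)"
  have "(z - w) * (\<integral>u. ?k z u * ?k w u \<partial>M) = N w - N z"
  proof -
    define I where "I = (\<integral>u. ?r z u * ?r w u \<partial>M)"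
    have eq: "?k z u * ?k w u = F z * F w * (?r z u * ?r w u) - (F z * ?r z u + F w * ?r w u - 1)" for u
      by (simp add: algebra_simps)
    have "(\<integral>u. F z * F w * (?r z u * ?r w u) - (F z * ?r z u + F w * ?r w u - 1) \<partial>M)
       = F z * F w * (\<integral>u. ?r z u * ?r w u \<partial>M) - (F z * (\<integral>u. ?r z u \<partial>M) + F w * (\<integral>u. ?r w u \<partial>M) - 1)"
      using integrable_mult_right[OF integrable_resolvent_mult[OF z w], of "F z * F w"]
        integrable_mult_right[OF integrable_resolvent[OF z], of "F z"]
        integrable_mult_right[OF integrable_resolvent[OF w], of "F w"]
      by (simp only: Bochner_Integration.integral_add Bochner_Integration.integral_diff
          Bochner_Integration.integrable_diff Bochner_Integration.integrable_add
          integrable_const prob_space lebesgue_integral_const scaleR_one integral_mult_right_zero)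
    also have "\<dots> = F z * F w * I - 1"
      using F_nonzero[OF z] F_nonzero[OF w] by (simp add: integral_resolvent I_def)
    finally have J: "(\<integral>u. ?k z u * ?k w u \<partial>M) = F z * F w * I - 1"
      unfolding eq .
    have "(z - w) * (\<integral>u. ?k z u * ?k w u \<partial>M) = - F z * F w * ((w - z) * I) - (z - w)"
      unfolding J by (simp add: algebra_simps)
    also have "(w - z) * I = 1 / F z - 1 / F w"
      using resolvent_identity[OF z w] by (simp add: cauchy_transform_eq I_def)
    also have "- F z * F w * (1 / F z - 1 / F w) - (z - w) = N w - N z"
      using F_nonzero[OF z] F_nonzero[OF w] by (simp add: N_def field_simps)
    finally show ?thesis .
  qed
  then have A: "cmod (N z - N w) = cmod (z - w) * cmod (\<integral>u. ?k z u * ?k w u \<partial>M)"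
    by (metis norm_minus_commute norm_mult)
  have B: "cmod (\<integral>u. ?k z u * ?k w u \<partial>M) \<le> (variance_F z + variance_F w) / 2"
  proof -
    have i: "integrable M (\<lambda>u. ((cmod (?k z u))\<^sup>2 + (cmod (?k w u))\<^sup>2) / 2)"
      by (intro integrable_divide Bochner_Integration.integrable_add fluctuation_norm_sq z w)
    have b: "cmod (?k z u * ?k w u) \<le> ((cmod (?k z u))\<^sup>2 + (cmod (?k w u))\<^sup>2) / 2" for u
      using sum_squares_bound[of "cmod (?k z u)" "cmod (?k w u)"] by (simp add: norm_mult)
    have "cmod (\<integral>u. ?k z u * ?k w u \<partial>M) \<le> (\<integral>u. ((cmod (?k z u))\<^sup>2 + (cmod (?k w u))\<^sup>2) / 2 \<partial>M)"
    proof (rule order_trans[OF integral_norm_bound], rule integral_mono)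
      show "integrable M (\<lambda>u. cmod (?k z u * ?k w u))"
        by (rule Bochner_Integration.integrable_bound[OF i]) (use b in \<open>auto intro: order_trans[OF _ abs_ge_self]\<close>)
    qed (use i b in auto)
    also have "\<dots> = (variance_F z + variance_F w) / 2"
      unfolding variance_F_def using fluctuation_norm_sq(1)[OF z] fluctuation_norm_sq(1)[OF w] by simp
    finally show ?thesis .
  qed
  show ?thesis unfolding A by (rule mult_left_mono[OF B norm_ge_zero])
qed

text \<open>Centering makes \<open>N z\<close> the mean of \<open>u * ?k u\<close>. A weighted
  arithmetic-geometric mean inequality bounds it by half of
  \<open>V / Im z + Im z * variance_F z\<close>; the last term equals \<open>- Im (N z)\<close> and
  is absorbed on the left.\<close>

lemma norm_N_le:
  assumes z: "Im z > 0"
  shows "cmod (N z) \<le> (\<integral>u. u\<^sup>2 \<partial>M) / Im z"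
proof -
  let ?k = "\<lambda>u. F z / (z - complex_of_real u) - 1"
  let ?r = "\<lambda>u. 1 / (z - complex_of_real u)"
  define V where "V = (\<integral>u. u\<^sup>2 \<partial>M)"
  have eq: "of_real u * ?k u = F z * (z * ?r u - 1) - of_real u" for u
    using diff_of_real_nonzero[OF z, of u] by (simp add: field_simps)
  have "(\<integral>u. of_real u * ?k u \<partial>M) = F z * (z * (\<integral>u. ?r u \<partial>M) - 1) - (\<integral>u. complex_of_real u \<partial>M)"
    unfolding eq
    using integrable_resolvent[OF z] integrable_mult_right[OF integrable_resolvent[OF z], of z]
      integrable_ident[THEN integrable_of_real[where 'a = complex]]
    by (simp only: Bochner_Integration.integral_diff Bochner_Integration.integrable_diff integrable_mult_right
          integrable_const prob_space lebesgue_integral_const scaleR_one integral_mult_right_zero)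
  also have "\<dots> = N z"
    using F_nonzero[OF z] by (simp add: integral_resolvent expectation_zero N_def field_simps)
  finally have N: "N z = (\<integral>u. of_real u * ?k u \<partial>M)" ..
  have i: "integrable M (\<lambda>u. (u\<^sup>2 / Im z + Im z * (cmod (?k u))\<^sup>2) / 2)"
    by (intro integrable_divide Bochner_Integration.integrable_add integrable_mult_right fluctuation_norm_sq z integrable_square)
  have b: "cmod (of_real u * ?k u) \<le> (u\<^sup>2 / Im z + Im z * (cmod (?k u))\<^sup>2) / 2" for u
  proof -
    have "2 * (\<bar>u\<bar> / sqrt (Im z)) * (sqrt (Im z) * cmod (?k u))
        \<le> (\<bar>u\<bar> / sqrt (Im z))\<^sup>2 + (sqrt (Im z) * cmod (?k u))\<^sup>2"
      by (rule sum_squares_bound)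
    then show ?thesis
      using z by (simp add: norm_mult power_divide power_mult_distrib)
  qed
  have "cmod (N z) \<le> (\<integral>u. (u\<^sup>2 / Im z + Im z * (cmod (?k u))\<^sup>2) / 2 \<partial>M)"
    unfolding N
  proof (rule order_trans[OF integral_norm_bound], rule integral_mono)
    show "integrable M (\<lambda>u. cmod (of_real u * ?k u))"
      by (rule Bochner_Integration.integrable_bound[OF i]) (use b in \<open>auto intro: order_trans[OF _ abs_ge_self]\<close>)
  qed (use i b in auto)
  also have "\<dots> = (V / Im z + Im z * variance_F z) / 2"
    unfolding variance_F_def V_def using fluctuation_norm_sq(1)[OF z] integrable_square by simp
  finally have "cmod (N z) \<le> (V / Im z + Im z * variance_F z) / 2" .
  moreover have "Im z * variance_F z \<le> cmod (N z)"
    using z fluctuation_norm_sq(2)[OF z] abs_Im_le_cmod[of "N z"] by simp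
  ultimately show ?thesis by (simp add: V_def)
qed

section \<open>Global inversion of \<open>z + t * N z\<close>, whose right inverse is the
  subordination function\<close>

definition subordination_inverse :: "real \<Rightarrow> complex \<Rightarrow> complex" where
  "subordination_inverse t z = z + t * N z"

text \<open>Hence the image stays in the upper half-plane exactly when
  \<open>t * variance_F z < 1\<close>, the condition under which the bound on differences of
  \<open>N\<close> becomes a contraction.\<close>

lemma Im_subordination_inverse:
  assumes "Im z > 0"
  shows "Im (subordination_inverse t z) = Im z * (1 - t * variance_F z)"
  using assms fluctuation_norm_sq(2)[OF assms] by (simp add: subordination_inverse_def algebra_simps)

text \<open>Equal images mean \<open>z - w = - t * (N z - N w)\<close>, but
  \<open>t * variance_F\<close> is below 1 at both points, so the right side is strictly shorter
  than \<open>z - w\<close> unless the points coincide.\<close>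

lemma subordination_inverse_inj:
  assumes "t \<ge> 0" and z: "Im z > 0" "Im (subordination_inverse t z) > 0"
    and w: "Im w > 0" "Im (subordination_inverse t w) > 0"
    and eq: "subordination_inverse t z = subordination_inverse t w"
  shows "z = w"
proof (rule ccontr)
  assume "z \<noteq> w"
  have "t * variance_F z < 1" "t * variance_F w < 1"
    using z w by (auto simp: Im_subordination_inverse zero_less_mult_iff)
  then have "t * ((variance_F z + variance_F w) / 2) < 1" by (simp add: algebra_simps)
  then have "cmod (z - w) * (t * ((variance_F z + variance_F w) / 2)) < cmod (z - w)"
    using \<open>z \<noteq> w\<close> by simp
  moreover have "cmod (z - w) = t * cmod (N z - N w)"
  proof -
    have "z - w = - of_real t * (N z - N w)"
      using eq by (simp add: subordination_inverse_def algebra_simps)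
    then show ?thesis using \<open>t \<ge> 0\<close> by (simp add: norm_mult)
  qed
  moreover have "t * cmod (N z - N w) \<le> t * (cmod (z - w) * ((variance_F z + variance_F w) / 2))"
    by (intro mult_left_mono norm_N_diff_le z w assms)
  ultimately show False by (simp add: algebra_simps)
qed

text \<open>A solution is a fixed point of \<open>w \<mapsto> z - t * N w\<close>. This map
  preserves the half-plane above \<open>z\<close> because \<open>Im (N w) \<le> 0\<close>, and the
  ball around \<open>z\<close> by \<open>norm_N_le\<close>, so Brouwer applies to their
  intersection.\<close>

lemma subordination_inverse_surj:
  assumes "t \<ge> 0" and z: "Im z > 0"
  obtains w where "Im w \<ge> Im z" "cmod (w - z) \<le> t * (\<integral>u. u\<^sup>2 \<partial>M) / Im z" "subordination_inverse t w = z"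
proof -
  let ?K = "{w. Im w \<ge> Im z} \<inter> cball z (t * (\<integral>u. u\<^sup>2 \<partial>M) / Im z)"
  have V: "(\<integral>u. u\<^sup>2 \<partial>M) \<ge> 0" by (rule Bochner_Integration.integral_nonneg) simp
  obtain w where w: "w \<in> ?K" "z - t * N w = w"
  proof (rule brouwer)
    show "compact ?K"
      by (intro closed_Int_compact compact_cball closed_halfspace_Im_ge)
    show "convex ?K"
      by (intro convex_Int convex_halfspace_Im_ge convex_cball)
    show "?K \<noteq> {}" using V z assms by (auto intro!: exI[of _ z])
    show "continuous_on ?K (\<lambda>w. z - t * N w)"
      using z by (intro continuous_intros holomorphic_on_imp_continuous_on
          holomorphic_on_subset[OF N_holomorphic]) auto
    show "(\<lambda>w. z - t * N w) \<in> ?K \<rightarrow> ?K"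
    proof (intro funcsetI)
      fix w assume w: "w \<in> ?K"
      then have "Im w > 0" using z by auto
      then have "t * Im (N w) \<le> 0"
        using Im_N_nonpos assms by (simp add: mult_nonneg_nonpos)
      moreover have "t * cmod (N w) \<le> t * ((\<integral>u. u\<^sup>2 \<partial>M) / Im z)"
        using w z V assms \<open>Im w > 0\<close>
        by (intro mult_left_mono order_trans[OF norm_N_le] divide_left_mono mult_pos_pos) auto
      ultimately show "z - t * N w \<in> ?K"
        using assms by (simp add: dist_norm norm_mult)
    qed
  qed
  show ?thesis
    by (rule that[of w]) (use w in \<open>auto simp: subordination_inverse_def dist_norm norm_minus_commute algebra_simps\<close>)
qed

end

section \<open>Subordination for free convolution powers\<close>

text \<open>Division by the positive real part leaves the argument unchanged and gives a quotient
  that tends to 1.\<close>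

lemma Im_Ln_tendsto_0:
  fixes f :: "'a \<Rightarrow> complex"
  assumes Re: "filterlim (\<lambda>x. Re (f x)) at_top G" and Im: "\<And>x. \<bar>Im (f x)\<bar> \<le> C"
  shows "((\<lambda>x. Im (Ln (f x))) \<longlongrightarrow> 0) G"
proof -
  have "((\<lambda>x. inverse (Re (f x)) * Im (f x)) \<longlongrightarrow> 0) G"
    by (rule lim_null_mult_right_bounded[where B = C])
       (use Im in \<open>auto intro!: tendsto_inverse_0_at_top Re\<close>)
  then have "((\<lambda>x. Ln (1 + \<i> * of_real (inverse (Re (f x)) * Im (f x)))) \<longlongrightarrow> Ln (1 + \<i> * of_real 0)) G"
    by (intro tendsto_intros) auto
  then have "((\<lambda>x. Im (Ln (1 + \<i> * of_real (inverse (Re (f x)) * Im (f x))))) \<longlongrightarrow> 0) G"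
    using tendsto_Im by fastforce
  moreover have "\<forall>\<^sub>F x in G. Im (Ln (1 + \<i> * of_real (inverse (Re (f x)) * Im (f x)))) = Im (Ln (f x))"
    using filterlim_at_top_dense[THEN iffD1, OF Re, rule_format, of 0]
  proof eventually_elim
    case (elim x)
    then have "f x \<noteq> 0" by auto
    have "1 + \<i> * of_real (inverse (Re (f x)) * Im (f x)) = f x / of_real (Re (f x))"
      using elim by (simp add: complex_eq_iff field_simps)
    then show ?case
      using Arg_divide_of_real[OF elim, of "f x"] elim \<open>f x \<noteq> 0\<close> by (simp add: Arg_def)
  qed
  ultimately show ?thesis
    by (rule Lim_transform_eventually)
qed

context real_distribution
begin

text \<open>This fixes the constant of integration when argument potentials are integrated along a
  horizontal line.\<close>

lemma arg_potential_tendsto_0: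
  assumes Re: "filterlim (\<lambda>k. Re (z k)) at_top sequentially" and Im: "\<And>k. Im (z k) > 0" "\<And>k. \<bar>Im (z k)\<bar> \<le> C"
  shows "(\<lambda>k. arg_potential M (z k)) \<longlonglongrightarrow> 0"
proof -
  have "(\<lambda>k. arg_potential M (z k)) \<longlonglongrightarrow> (\<integral>u. 0 \<partial>M)"
    unfolding arg_potential_def
  proof (rule integral_dominated_convergence[where w = "\<lambda>_. pi"])
    show "AE u in M. (\<lambda>k. Im (Ln (z k - complex_of_real u))) \<longlonglongrightarrow> 0"
    proof (intro AE_I2 Im_Ln_tendsto_0)
      fix u
      have "filterlim (\<lambda>k. - u + Re (z k)) at_top sequentially"
        by (rule filterlim_tendsto_add_at_top[OF tendsto_const Re])
      then show "filterlim (\<lambda>k. Re (z k - complex_of_real u)) at_top sequentially"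
        by (simp add: algebra_simps)
    qed (use Im in auto)
    show "AE u in M. norm (Im (Ln (z k - complex_of_real u))) \<le> pi" for k
      using Im_Ln_bounds[OF Im(1)] by (intro AE_I2) (auto simp: abs_le_iff less_imp_le intro: order_trans[of _ 0])
  qed auto
  then show ?thesis by simp
qed

end

section \<open>Uniqueness of the inverses of \<open>F\<close>, and analytic subordination\<close>

context centered_distribution
begin

text \<open>Between two such points \<open>N\<close> strictly contracts the distance, so
  \<open>F\<close>, the identity minus \<open>N\<close>, separates them.\<close>

lemma F_inj:
  assumes z: "Im z > 0" "variance_F z < 1" and w: "Im w > 0" "variance_F w < 1" and eq: "F z = F w"
  shows "z = w"
proof (rule ccontr)
  assume "z \<noteq> w"
  have "cmod (z - w) = cmod (N z - N w)" using eq by (simp add: N_def)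
  also have "\<dots> \<le> cmod (z - w) * ((variance_F z + variance_F w) / 2)"
    by (intro norm_N_diff_le z w)
  also have "\<dots> < cmod (z - w) * 1"
    using \<open>z \<noteq> w\<close> z w by (intro mult_strict_left_mono) auto
  finally show False by simp
qed

text \<open>By \<open>norm_N_le\<close> the variance is at most the second moment divided by the
  squared height, and at this height the quotient is below 1.\<close>

lemma variance_F_less_1:
  assumes "Im z > 1 + (\<integral>u. u\<^sup>2 \<partial>M)"
  shows "variance_F z < 1"
proof -
  define V where "V = (\<integral>u. u\<^sup>2 \<partial>M)"
  have V: "V \<ge> 0" unfolding V_def by (rule Bochner_Integration.integral_nonneg) simp
  have z: "Im z > 1 + V" "Im z > 0" using assms V by (auto simp flip: V_def)
  have "variance_F z * Im z = - Im (N z)"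
    using fluctuation_norm_sq(2)[OF z(2)] z by simp
  also have "\<dots> \<le> cmod (N z)"
    using abs_Im_le_cmod[of "N z"] by simp
  also have "\<dots> \<le> V / Im z"
    using norm_N_le[OF z(2)] by (simp add: V_def)
  also have "\<dots> < Im z"
  proof -
    have "V < 1 * Im z" using z by simp
    also have "\<dots> \<le> Im z * Im z" using z V by (intro mult_right_mono) auto
    finally show ?thesis using z by (simp add: divide_less_eq)
  qed
  finally show ?thesis using z by simp
qed

definition subordination_domain :: "real \<Rightarrow> complex set" where
  "subordination_domain t = {w. Im w > 0 \<and> Im (subordination_inverse t w) > 0}"

lemma subordination_inverse_holomorphic: "subordination_inverse t holomorphic_on upper_half_plane"
  unfolding subordination_inverse_def[abs_def] by (intro holomorphic_intros N_holomorphic)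

lemma open_subordination_domain: "open (subordination_domain t)"
proof -
  have "open (upper_half_plane \<inter> subordination_inverse t -` upper_half_plane)"
    by (intro continuous_open_preimage open_upper_half_plane holomorphic_on_imp_continuous_on
        subordination_inverse_holomorphic)
  also have "upper_half_plane \<inter> subordination_inverse t -` upper_half_plane = subordination_domain t"
    by (auto simp: subordination_domain_def)
  finally show ?thesis .
qed

text \<open>Injectivity gives a holomorphic inverse on the image, and the Brouwer solution shows
  that the image is the whole upper half-plane. The distance bound controls \<open>g\<close> along
  horizontal lines for the limit at infinity.\<close>

lemma subordination_function:
  assumes "t \<ge> 0"
  obtains g where "g holomorphic_on upper_half_plane"
    and "\<And>w. w \<in> subordination_domain t \<Longrightarrow> g (subordination_inverse t w) = w"
    and "\<And>z. Im z > 0 \<Longrightarrow> g z \<in> subordination_domain t"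
    and "\<And>z. Im z > 0 \<Longrightarrow> subordination_inverse t (g z) = z"
    and "\<And>z. Im z > 0 \<Longrightarrow> Im (g z) \<ge> Im z \<and> cmod (g z - z) \<le> t * (\<integral>u. u\<^sup>2 \<partial>M) / Im z"
proof -
  let ?D = "subordination_domain t" and ?s = "subordination_inverse t"
  have hol: "?s holomorphic_on ?D"
    by (rule holomorphic_on_subset[OF subordination_inverse_holomorphic]) (auto simp: subordination_domain_def)
  have inj: "inj_on ?s ?D"
    using subordination_inverse_inj[OF assms] by (auto simp: inj_on_def subordination_domain_def)
  obtain g where g: "g holomorphic_on (?s ` ?D)" "\<And>w. w \<in> ?D \<Longrightarrow> g (?s w) = w"
    using holomorphic_has_inverse[OF hol open_subordination_domain inj] by metis
  have *: "\<exists>w\<in>?D. ?s w = z \<and> Im w \<ge> Im z \<and> cmod (w - z) \<le> t * (\<integral>u. u\<^sup>2 \<partial>M) / Im z" if z: "Im z > 0" for z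
  proof -
    obtain w where w: "Im w \<ge> Im z" "cmod (w - z) \<le> t * (\<integral>u. u\<^sup>2 \<partial>M) / Im z" "?s w = z"
      using subordination_inverse_surj[OF assms z] by blast
    then show ?thesis using z by (intro bexI[of _ w]) (auto simp: subordination_domain_def)
  qed
  have im: "?s ` ?D = upper_half_plane"
    using * by (fastforce simp: subordination_domain_def)
  show ?thesis
  proof (rule that[of g])
    show "g holomorphic_on upper_half_plane" using g(1) by (simp only: im)
    fix z :: complex assume "Im z > 0"
    then obtain w where w: "w \<in> ?D" "?s w = z" "Im w \<ge> Im z" "cmod (w - z) \<le> t * (\<integral>u. u\<^sup>2 \<partial>M) / Im z"
      using * by blast
    have "g z = w" using g(2)[OF w(1)] w(2) by simp
    then show "g z \<in> ?D" "?s (g z) = z" "Im (g z) \<ge> Im z \<and> cmod (g z - z) \<le> t * (\<integral>u. u\<^sup>2 \<partial>M) / Im z"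
      using w by auto
  qed (use g in auto)
qed

text \<open>The definition of free convolution admits a different transform for each index. The
  normalization \<open>H z / z \<rightarrow> 1\<close> lifts all values into the region where
  \<open>F\<close> is injective, so they agree on a higher cone.\<close>

lemma right_inverses_eventually_unique:
  assumes fin: "finite I" and "\<alpha> > 0"
    and inv: "\<And>i. i \<in> I \<Longrightarrow> is_recip_cauchy_inverse M \<alpha> \<beta> (h i)"
  obtains b where "b \<ge> \<beta>" "\<And>i j z. i \<in> I \<Longrightarrow> j \<in> I \<Longrightarrow> z \<in> truncated_cone \<alpha> b \<Longrightarrow> h i z = h j z"
proof -
  define V where "V = (\<integral>u. u\<^sup>2 \<partial>M)"
  have V: "V \<ge> 0" unfolding V_def by (rule Bochner_Integration.integral_nonneg) simp
  \<comment> \<open>In the cone \<open>cmod z \<le> (1 + \<alpha>) * Im z\<close>, so a relative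
    error \<open>e\<close> is an absolute error of at most \<open>Im z / 2\<close>.\<close>
  define e where "e = 1 / (2 * (1 + \<alpha>))"
  have e: "e > 0" using \<open>\<alpha> > 0\<close> by (simp add: e_def)
  have "\<forall>\<^sub>F z in at_infinity. \<forall>i\<in>I. z \<in> truncated_cone \<alpha> \<beta> \<longrightarrow> dist (h i z / z) 1 < e"
  proof (rule eventually_ball_finite[OF fin], intro ballI)
    fix i assume "i \<in> I"
    then have "((\<lambda>z. h i z / z) \<longlongrightarrow> 1) (inf at_infinity (principal (truncated_cone \<alpha> \<beta>)))"
      using inv by (simp add: is_recip_cauchy_inverse_def)
    from tendstoD[OF this e] show "\<forall>\<^sub>F z in at_infinity. z \<in> truncated_cone \<alpha> \<beta> \<longrightarrow> dist (h i z / z) 1 < e"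
      by (simp add: eventually_inf_principal)
  qed
  then obtain R where R: "\<And>z i. R \<le> cmod z \<Longrightarrow> i \<in> I \<Longrightarrow> z \<in> truncated_cone \<alpha> \<beta> \<Longrightarrow> dist (h i z / z) 1 < e"
    unfolding eventually_at_infinity by blast
  \<comment> \<open>Half of any height above \<open>2 + 2 * V\<close> exceeds \<open>1 + V\<close>,
    the threshold of \<open>variance_F_less_1\<close>.\<close>
  define b where "b = max \<beta> (max R (2 + 2 * V))"
  have b: "b \<ge> \<beta>" "b \<ge> R" "b \<ge> 2 + 2 * V" by (simp_all add: b_def)
  have F: "Im (h i z) > 0 \<and> variance_F (h i z) < 1 \<and> F (h i z) = z"
    if "i \<in> I" "z \<in> truncated_cone \<alpha> b" for i z
  proof -
    have z: "Im z > b" "\<bar>Re z\<bar> < \<alpha> * Im z" "z \<in> truncated_cone \<alpha> \<beta>"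
      using that b by (auto simp: truncated_cone_def)
    have "Im z > 0" using z(1) b(3) V by linarith
    then have "z \<noteq> 0" by auto
    have "Im z \<le> cmod z" using abs_Im_le_cmod[of z] by simp
    then have "dist (h i z / z) 1 < e" using z b that by (intro R) auto
    moreover have "h i z - z = z * (h i z / z - 1)" using \<open>z \<noteq> 0\<close> by (simp add: field_simps)
    ultimately have "cmod (h i z - z) \<le> cmod z * e"
      by (simp add: norm_mult dist_norm mult_left_mono)
    also have "\<dots> \<le> ((1 + \<alpha>) * Im z) * e"
      using cmod_le[of z] z \<open>Im z > 0\<close> e by (intro mult_right_mono) (auto simp: algebra_simps)
    also have "\<dots> = Im z / 2" using \<open>\<alpha> > 0\<close> by (simp add: e_def divide_simps algebra_simps)
    finally have "cmod (h i z - z) \<le> Im z / 2" .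
    then have "Im (h i z) \<ge> Im z / 2"
      using abs_Im_le_cmod[of "h i z - z"] by (simp add: abs_le_iff)
    then have "Im (h i z) > 1 + V" using z(1) b(3) by linarith
    then show ?thesis
      using inv[OF that(1)] z variance_F_less_1[of "h i z"]
      by (auto simp: is_recip_cauchy_inverse_def F_def V_def)
  qed
  show ?thesis
    by (rule that[of b], fact b, rule F_inj) (simp_all add: F)
qed

text \<open>If \<open>F (h z) = z\<close> and \<open>h z = z + \<phi> z\<close>, then
  \<open>N (h z) = \<phi> z\<close>, so with \<open>t = n - 1\<close> the map sends
  \<open>h z\<close> to \<open>z + n * \<phi> z\<close>, which is the inverse belonging to \<nu>.
  This settles a high cone; analytic continuation does the rest.\<close>

lemma free_convolution_subordination:
  assumes conv: "is_free_convolution_power n M \<nu>" and "n \<ge> 1"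
    and w: "w \<in> subordination_domain (real n - 1)"
  shows "recip_cauchy_transform \<nu> (subordination_inverse (real n - 1) w) = F w"
proof -
  let ?t = "real n - 1"
  let ?s = "subordination_inverse ?t"
  have t: "?t \<ge> 0" using \<open>n \<ge> 1\<close> by simp
  obtain \<alpha> \<beta> \<phi> \<psi> where ab: "\<alpha> > 0" "\<beta> > 0" and nu: "real_distribution \<nu>"
    and phi: "\<And>i. i \<in> {1..n} \<Longrightarrow> is_recip_cauchy_inverse M \<alpha> \<beta> (\<lambda>z. z + \<phi> i z)"
    and psi: "is_recip_cauchy_inverse \<nu> \<alpha> \<beta> (\<lambda>z. z + \<psi> z)"
    and psi_sum: "\<And>z. z \<in> truncated_cone \<alpha> \<beta> \<Longrightarrow> \<psi> z = (\<Sum>i\<in>{1..n}. \<phi> i z)"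
    using conv unfolding is_free_convolution_power_def is_free_convolution_def is_voiculescu_transform_def
    by blast
  interpret nu: real_distribution \<nu> by (rule nu)
  obtain b where b: "b \<ge> \<beta>" and uniq: "\<And>i j z. i \<in> {1..n} \<Longrightarrow> j \<in> {1..n} \<Longrightarrow> z \<in> truncated_cone \<alpha> b
      \<Longrightarrow> z + \<phi> i z = z + \<phi> j z"
    using right_inverses_eventually_unique[OF _ ab(1), of "{1..n}" \<beta> "\<lambda>i z. z + \<phi> i z"] phi by auto
  let ?C = "truncated_cone \<alpha> b"
  define h where "h z = z + \<phi> 1 z" for z
  define H where "H z = z + \<psi> z" for z
  have sub: "?C \<subseteq> truncated_cone \<alpha> \<beta>" using b by (auto simp: truncated_cone_def)
  have h: "Im (h z) > 0" "F (h z) = z" if "z \<in> ?C" for z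
    using phi[of 1] that sub \<open>n \<ge> 1\<close> by (auto simp: is_recip_cauchy_inverse_def h_def F_def)
  have H: "Im (H z) > 0" "recip_cauchy_transform \<nu> (H z) = z" if "z \<in> ?C" for z
    using psi that sub by (auto simp: is_recip_cauchy_inverse_def H_def)
  have sh: "?s (h z) = H z" if "z \<in> ?C" for z
  proof -
    have "\<psi> z = (\<Sum>i\<in>{1..n}. \<phi> 1 z)"
    proof -
      have "\<psi> z = (\<Sum>i\<in>{1..n}. \<phi> i z)"
        using that sub by (intro psi_sum) auto
      also have "\<dots> = (\<Sum>i\<in>{1..n}. \<phi> 1 z)"
      proof (rule sum.cong)
        fix i assume "i \<in> {1..n}"
        from uniq[OF this _ that, of 1] show "\<phi> i z = \<phi> 1 z" using \<open>n \<ge> 1\<close> by simp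
      qed simp
      finally show ?thesis .
    qed
    then have "\<psi> z = of_nat n * \<phi> 1 z" by simp
    then show ?thesis
      using h(2)[OF that] by (simp add: subordination_inverse_def N_def H_def algebra_simps) (simp add: h_def algebra_simps)
  qed
  obtain g where g: "g holomorphic_on upper_half_plane"
    "\<And>w. w \<in> subordination_domain ?t \<Longrightarrow> g (?s w) = w"
    "\<And>z. Im z > 0 \<Longrightarrow> g z \<in> subordination_domain ?t"
    by (rule subordination_function[OF t]) (rule that)
  have gH: "g (H z) = h z" if "z \<in> ?C" for z
    using g(2)[of "h z"] h H sh that by (simp add: subordination_domain_def)
  \<comment> \<open>Both sides are holomorphic on the half-plane and agree on the image of
    \<open>?C\<close> under \<open>H\<close>. That image is open because \<open>H\<close> has a left
    inverse and is therefore injective.\<close>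
  have "recip_cauchy_transform \<nu> z = F (g z)" if "Im z > 0" for z
  proof (rule analytic_continuation_open[of "H ` ?C" upper_half_plane "recip_cauchy_transform \<nu>" "\<lambda>z. F (g z)"])
    have "open ?C"
    proof -
      have "?C = {z. b < Im z} \<inter> {z. \<bar>Re z\<bar> - \<alpha> * Im z < 0}" by (auto simp: truncated_cone_def)
      also have "open \<dots>"
        by (intro open_Int open_halfspace_Im_gt open_Collect_less continuous_intros)
      finally show ?thesis .
    qed
    moreover have "H holomorphic_on ?C"
      using psi sub unfolding is_recip_cauchy_inverse_def H_def by (auto intro: holomorphic_on_subset)
    moreover have "inj_on H ?C" by (rule inj_on_inverseI) (rule H(2))
    ultimately show "open (H ` ?C)" by (intro open_mapping_thm3)
    have "Complex 0 (\<bar>b\<bar> + 1) \<in> ?C" using ab by (auto simp: truncated_cone_def)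
    then show "H ` ?C \<noteq> {}" by blast
    show "connected upper_half_plane" by (rule convex_connected[OF convex_upper_half_plane])
    show "H ` ?C \<subseteq> upper_half_plane" using H by auto
    show "recip_cauchy_transform \<nu> holomorphic_on upper_half_plane"
      by (rule nu.recip_cauchy_transform_holomorphic)
    show "(\<lambda>z. F (g z)) holomorphic_on upper_half_plane"
      using holomorphic_on_compose_gen[OF g(1) F_holomorphic] g(3)
      by (auto simp: comp_def subordination_domain_def)
    show "\<And>z. z \<in> H ` ?C \<Longrightarrow> recip_cauchy_transform \<nu> z = F (g z)"
      using H h gH by auto
  qed (use that open_upper_half_plane in auto)
  from this[of "?s w"] g(2)[OF w] w show ?thesis
    by (simp add: subordination_domain_def)
qed

text \<open>Along the horizontal line through the image of \<open>w\<close>, the difference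
  \<open>D\<close> of the two sides has derivative zero and tends to 0 at plus infinity.\<close>

lemma arg_potential_subordination:
  assumes conv: "is_free_convolution_power n M \<nu>" and "n \<ge> 1"
    and w: "w \<in> subordination_domain (real n - 1)"
  shows "arg_potential \<nu> (subordination_inverse (real n - 1) w)
    = n * arg_potential M w - (real n - 1) * Im (Ln (F w))"
proof -
  let ?t = "real n - 1"
  let ?s = "subordination_inverse ?t"
  have t: "?t \<ge> 0" using \<open>n \<ge> 1\<close> by simp
  have "real_distribution \<nu>"
    using conv by (simp add: is_free_convolution_power_def is_free_convolution_def)
  then interpret nu: real_distribution \<nu> .
  define V where "V = (\<integral>u. u\<^sup>2 \<partial>M)"
  have V: "V \<ge> 0" unfolding V_def by (rule Bochner_Integration.integral_nonneg) simp
  obtain g where g: "g holomorphic_on upper_half_plane"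
    "\<And>w. w \<in> subordination_domain ?t \<Longrightarrow> g (?s w) = w"
    "\<And>z. Im z > 0 \<Longrightarrow> g z \<in> subordination_domain ?t"
    "\<And>z. Im z > 0 \<Longrightarrow> ?s (g z) = z"
    "\<And>z. Im z > 0 \<Longrightarrow> Im (g z) \<ge> Im z \<and> cmod (g z - z) \<le> ?t * (\<integral>u. u\<^sup>2 \<partial>M) / Im z"
    by (rule subordination_function[OF t]) (rule that)
  note g5 = g(5)[folded V_def]
  have gpos: "Im (g z) > 0" if "Im z > 0" for z
    using g(3)[OF that] by (simp add: subordination_domain_def)
  define y where "y = Im (?s w)"
  have y: "y > 0" using w by (simp add: y_def subordination_domain_def)
  define p where "p x = Complex x y" for x
  have p: "Im (p x) > 0" for x using y by (simp add: p_def)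
  define D where "D x = arg_potential \<nu> (p x) - n * arg_potential M (g (p x)) + ?t * Im (Ln (F (g (p x))))" for x
  have "DERIV D x :> 0" for x
  proof -
    let ?z = "p x"
    obtain g' where g': "(g has_field_derivative g') (at ?z)"
      using g(1) p by (auto simp: holomorphic_on_open open_upper_half_plane)
    obtain F' where F': "(F has_field_derivative F') (at (g ?z))"
      using F_holomorphic gpos[OF p] by (auto simp: holomorphic_on_open open_upper_half_plane)
    have F0: "F (g ?z) \<noteq> 0" "Im (F (g ?z)) > 0"
      using F_nonzero[OF gpos[OF p[of x]]] Im_F_ge[OF gpos[OF p[of x]]] gpos[OF p[of x]] by auto
    have "((\<lambda>z. ?s (g z)) has_field_derivative (g' + ?t * (g' - F' * g'))) (at ?z)"
      unfolding subordination_inverse_def N_def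
      by (intro DERIV_add DERIV_cmult DERIV_diff g' DERIV_chain2[where g = g, OF F'])
    moreover have "((\<lambda>z. ?s (g z)) has_field_derivative 1) (at ?z)"
    proof (rule DERIV_cong[OF has_field_derivative_transform_within_open[of "\<lambda>z. z"]])
      show "open upper_half_plane" by (rule open_upper_half_plane)
    qed (use p g(4) in \<open>auto intro: derivative_eq_intros\<close>)
    \<comment> \<open>The derivative of the identity \<open>?s (g z) = z\<close>; it is exactly the
      relation that cancels the derivative of \<open>D\<close>.\<close>
    ultimately have eq: "g' + ?t * (g' - F' * g') = 1"
      by (rule DERIV_unique)
    have dp: "(p has_vector_derivative 1) (at x)"
      by (simp add: has_vector_derivative_complex_iff p_def)
    have dg: "((\<lambda>x. g (p x)) has_vector_derivative g') (at x)"
      using field_vector_diff_chain_at[OF dp g'] by (simp add: comp_def)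
    have "((\<lambda>x. Ln (F (g (p x)))) has_vector_derivative (F' / F (g ?z) * g')) (at x)"
    proof -
      have "((\<lambda>w. Ln (F w)) has_field_derivative F' / F (g ?z)) (at (g ?z))"
        using F0 by (auto intro!: derivative_eq_intros F' simp: complex_nonpos_Reals_iff divide_inverse)
      from field_vector_diff_chain_at[OF dg this] show ?thesis by (simp add: comp_def mult.commute)
    qed
    then have d3: "((\<lambda>x. Im (Ln (F (g (p x))))) has_real_derivative Im (F' / F (g ?z) * g')) (at x)"
      by (rule has_field_derivative_Im)
    have lin: "(\<lambda>h. Im (c * (h *\<^sub>R d))) = (*) (Im (c * d))" for c d
      by (auto simp: fun_eq_iff algebra_simps)
    have d1: "((\<lambda>x. arg_potential \<nu> (p x)) has_real_derivative Im (1 / F (g ?z))) (at x)"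
    proof -
      have "((\<lambda>x. arg_potential \<nu> (p x)) has_derivative (\<lambda>h. Im (cauchy_transform \<nu> ?z * (h *\<^sub>R 1)))) (at x)"
        by (rule has_derivative_compose[OF dp[unfolded has_vector_derivative_def] nu.arg_potential_has_derivative[OF p]])
      moreover have "cauchy_transform \<nu> ?z = 1 / F (g ?z)"
        using free_convolution_subordination[OF conv \<open>n \<ge> 1\<close> g(3)[OF p[of x]]] g(4)[OF p[of x]]
        by (simp add: recip_cauchy_transform_def) (metis div_by_1 divide_divide_eq_right mult_1)
      ultimately show ?thesis
        unfolding has_field_derivative_def lin by simp
    qed
    have d2: "((\<lambda>x. arg_potential M (g (p x))) has_real_derivative Im (g' / F (g ?z))) (at x)"
    proof -
      have "((\<lambda>x. arg_potential M (g (p x))) has_derivative (\<lambda>h. Im (cauchy_transform M (g ?z) * (h *\<^sub>R g')))) (at x)"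
        by (rule has_derivative_compose[OF dg[unfolded has_vector_derivative_def] arg_potential_has_derivative[OF gpos[OF p]]])
      then show ?thesis
        unfolding has_field_derivative_def lin by (simp add: cauchy_transform_eq)
    qed
    have "(D has_real_derivative Im (1 / F (g ?z)) - n * Im (g' / F (g ?z)) + ?t * Im (F' / F (g ?z) * g')) (at x)"
      unfolding D_def by (intro DERIV_add DERIV_diff DERIV_cmult d1 d2 d3)
    also have "Im (1 / F (g ?z)) - n * Im (g' / F (g ?z)) + ?t * Im (F' / F (g ?z) * g')
       = Im (1 / F (g ?z) - of_real (real n) * (g' / F (g ?z)) + of_real ?t * (F' / F (g ?z) * g'))"
      by (simp only: plus_complex.sel minus_complex.sel times_complex.sel Re_complex_of_real Im_complex_of_real
          mult_zero_left add_0_right)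
    also have "1 / F (g ?z) - of_real (real n) * (g' / F (g ?z)) + of_real ?t * (F' / F (g ?z) * g')
       = (1 - (g' + ?t * (g' - F' * g'))) / F (g ?z)"
      using F0 by (simp add: field_simps)
    also have "\<dots> = 0" unfolding eq by simp
    finally show ?thesis by simp
  qed
  then have const: "D x = D x'" for x x'
    using DERIV_isconst_all by blast
  \<comment> \<open>On the line, \<open>g\<close> stays within the fixed distance
    \<open>?t * V / y\<close> of the identity, so its real part escapes to infinity while its
    imaginary part stays bounded.\<close>
  have ReIm: "filterlim (\<lambda>k. Re (g (p (real k)))) at_top sequentially" "\<bar>Im (g (p x))\<bar> \<le> y + ?t * V / y"
    for x
  proof -
    have b: "\<bar>Re (g (p x)) - x\<bar> \<le> ?t * V / y" "\<bar>Im (g (p x)) - y\<bar> \<le> ?t * V / y" for x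
      using g5[OF p[of x]] abs_Re_le_cmod[of "g (p x) - p x"] abs_Im_le_cmod[of "g (p x) - p x"]
      by (auto simp: p_def)
    show "\<bar>Im (g (p x))\<bar> \<le> y + ?t * V / y" using b(2)[of x] y by (simp add: abs_le_iff)
    have "filterlim (\<lambda>k. real k - ?t * V / y) at_top sequentially"
      using filterlim_tendsto_add_at_top[OF tendsto_const filterlim_real_sequentially, of "- (?t * V / y)"] by simp
    then show "filterlim (\<lambda>k. Re (g (p (real k)))) at_top sequentially"
    proof (rule filterlim_at_top_mono)
      have "real k - ?t * V / y \<le> Re (g (p (real k)))" for k
        using b(1)[of "real k"] by (simp add: abs_le_iff)
      then show "\<forall>\<^sub>F k in sequentially. real k - ?t * V / y \<le> Re (g (p (real k)))" by simp
    qed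
  qed
  have "(\<lambda>k. D (real k)) \<longlonglongrightarrow> 0 - real n * 0 + ?t * 0"
  proof -
    have A: "(\<lambda>k. arg_potential \<nu> (p (real k))) \<longlonglongrightarrow> 0"
      by (rule nu.arg_potential_tendsto_0[where C = y]) (use p y in \<open>auto simp: p_def filterlim_real_sequentially\<close>)
    have B: "(\<lambda>k. arg_potential M (g (p (real k)))) \<longlonglongrightarrow> 0"
      by (rule arg_potential_tendsto_0) (use ReIm gpos p in auto)
    have NV: "cmod (N (g (p x))) \<le> V / y" for x
    proof -
      have "cmod (N (g (p x))) \<le> V / Im (g (p x))"
        using norm_N_le[OF gpos[OF p]] by (simp add: V_def)
      also have "\<dots> \<le> V / y"
        using g5[OF p[of x]] y V by (intro divide_left_mono mult_pos_pos) (auto simp: p_def)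
      finally show ?thesis .
    qed
    have C: "(\<lambda>k. Im (Ln (F (g (p (real k)))))) \<longlonglongrightarrow> 0"
    proof (rule Im_Ln_tendsto_0[where f = "\<lambda>k. F (g (p (real k)))" and C = "y + ?t * V / y + V / y"])
      show "\<bar>Im (F (g (p (real k))))\<bar> \<le> y + ?t * V / y + V / y" for k
        using ReIm(2)[of "real k"] NV[of "real k"] abs_Im_le_cmod[of "N (g (p (real k)))"]
        by (simp add: N_def abs_le_iff)
      have "filterlim (\<lambda>k. Re (g (p (real k))) - V / y) at_top sequentially"
        using filterlim_tendsto_add_at_top[OF tendsto_const ReIm(1), of "- (V / y)"] by simp
      then show "filterlim (\<lambda>k. Re (F (g (p (real k))))) at_top sequentially"
      proof (rule filterlim_at_top_mono)
        have "Re (g (p (real k))) - V / y \<le> Re (F (g (p (real k))))" for k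
          using NV[of "real k"] abs_Re_le_cmod[of "N (g (p (real k)))"] by (simp add: N_def abs_le_iff)
        then show "\<forall>\<^sub>F k in sequentially. Re (g (p (real k))) - V / y \<le> Re (F (g (p (real k))))" by simp
      qed
    qed
    show ?thesis
      unfolding D_def by (rule tendsto_add[OF tendsto_diff[OF A tendsto_mult_left[OF B]] tendsto_mult_left[OF C]])
  qed
  moreover have "(\<lambda>k. D (real k)) = (\<lambda>k. D (Re (?s w)))"
    using const by blast
  ultimately have "D (Re (?s w)) = 0"
    by (simp add: LIMSEQ_const_iff)
  moreover have "p (Re (?s w)) = ?s w" by (simp add: p_def y_def)
  ultimately show ?thesis
    using g(2)[OF w] by (simp add: D_def)
qed

end

section \<open>Estimates near the unit circle\<close>

text \<open>The derivative of the remainder is \<open>- v\<^sup>2 / (1 - v)\<close>, and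
  \<open>cmod (1 - v) \<ge> 1 / 2\<close> on the disc.\<close>

lemma norm_Ln_cubic_remainder_le:
  fixes w :: complex
  assumes "cmod w \<le> 1 / 2"
  shows "cmod (Ln (1 - w) + w + w\<^sup>2 / 2) \<le> 2 * cmod w ^ 3"
proof -
  define f where "f v = Ln (1 - v) + v + v\<^sup>2 / 2" for v :: complex
  have "cmod (f w - f 0) \<le> (2 * (cmod w)\<^sup>2) * cmod (w - 0)"
  proof (rule field_differentiable_bound[of "cball 0 (cmod w)"])
    fix v :: complex assume "v \<in> cball 0 (cmod w)"
    then have v: "cmod v \<le> cmod w" "cmod v \<le> 1 / 2" using assms by auto
    have "Re (1 - v) > 0" using v abs_Re_le_cmod[of v] by auto
    then have "1 - v \<notin> \<real>\<^sub>\<le>\<^sub>0" "1 - v \<noteq> 0" by (auto simp: complex_nonpos_Reals_iff)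
    then show "(f has_field_derivative (- (v\<^sup>2 / (1 - v)))) (at v within cball 0 (cmod w))"
      unfolding f_def
      by (auto intro!: derivative_eq_intros simp: field_simps power2_eq_square)
    have "1 / 2 \<le> cmod (1 - v)"
      using v norm_triangle_ineq2[of 1 v] by simp
    then have "cmod (v\<^sup>2 / (1 - v)) \<le> (cmod v)\<^sup>2 / (1 / 2)"
      unfolding norm_divide norm_power by (intro divide_left_mono) auto
    also have "\<dots> \<le> 2 * (cmod w)\<^sup>2" using power_mono[OF v(1), of 2] by simp
    finally show "cmod (- (v\<^sup>2 / (1 - v))) \<le> 2 * (cmod w)\<^sup>2" by simp
  qed auto
  then show ?thesis by (simp add: f_def power3_eq_cube power2_eq_square)
qed

lemma one_div_cis: "1 / cis a = cis (- a)"
  by (simp only: cis_inverse[symmetric] inverse_eq_divide)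

text \<open>The derivative of \<open>Q\<close> is
  \<open>(v - cis \<theta>) * (v - cis (- \<theta>)) / v ^ 3\<close>. Its first factor vanishes at
  \<open>cis \<theta>\<close> and its second is at most \<open>9 / 4 * sin \<theta>\<close>, so the
  error is quadratic in \<rho> with an extra factor \<open>sin \<theta>\<close>; 16/3 is 9/4 divided
  by the cube of 3/4.\<close>

lemma semicircle_potential_bound:
  assumes \<theta>: "0 < \<theta>" "\<theta> < pi" and Z: "cmod (Z - cis \<theta>) \<le> \<rho>" and \<rho>: "\<rho> \<le> sin \<theta> / 4"
  shows "\<bar>Im (Ln Z - 1 / (2 * Z\<^sup>2) + complex_of_real (2 * cos \<theta>) / Z) - (\<theta> - sin (2 * \<theta>) / 2)\<bar>
    \<le> 16 / 3 * \<rho>\<^sup>2 * sin \<theta>"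
proof -
  define s where "s = sin \<theta>"
  have s: "0 < s" "s \<le> 1" using \<theta> by (auto simp: s_def sin_gt_zero)
  have "\<rho> \<ge> 0" using Z norm_ge_zero order_trans by blast
  define Q where "Q v = Ln v - 1 / (2 * v\<^sup>2) + complex_of_real (2 * cos \<theta>) / v" for v
  have "cmod (Q Z - Q (cis \<theta>)) \<le> (16 / 3 * \<rho> * s) * cmod (Z - cis \<theta>)"
  proof (rule field_differentiable_bound[of "cball (cis \<theta>) \<rho>"])
    fix v assume "v \<in> cball (cis \<theta>) \<rho>"
    then have v: "cmod (v - cis \<theta>) \<le> \<rho>" by (simp add: dist_norm norm_minus_commute)
    have "Im v > 0" using v abs_Im_le_cmod[of "v - cis \<theta>"] \<rho> s by (auto simp: s_def)
    then have v0: "v \<noteq> 0" "v \<notin> \<real>\<^sub>\<le>\<^sub>0" by (auto simp: complex_nonpos_Reals_iff)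
    have "cmod (cis \<theta>) \<le> cmod v + cmod (v - cis \<theta>)"
      using norm_triangle_ineq2[of "cis \<theta>" v] by (simp add: norm_minus_commute)
    then have cv: "3 / 4 \<le> cmod v" using v \<rho>[folded s_def] s by simp
    have "(Q has_field_derivative (1 / v + 1 / v ^ 3 - complex_of_real (2 * cos \<theta>) / v\<^sup>2)) (at v within cball (cis \<theta>) \<rho>)"
      unfolding Q_def using v0
      by (auto intro!: derivative_eq_intros simp: field_simps power2_eq_square power3_eq_cube)
    also have "1 / v + 1 / v ^ 3 - complex_of_real (2 * cos \<theta>) / v\<^sup>2 = (v - cis \<theta>) * (v - cis (- \<theta>)) / v ^ 3"
    proof -
      have "complex_of_real (2 * cos \<theta>) = cis \<theta> + cis (- \<theta>)" "cis \<theta> * cis (- \<theta>) = 1"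
        by (auto simp: complex_eq_iff cis_mult)
      then show ?thesis using v0 by (simp add: field_simps power2_eq_square power3_eq_cube)
    qed
    finally show "(Q has_field_derivative (v - cis \<theta>) * (v - cis (- \<theta>)) / v ^ 3) (at v within cball (cis \<theta>) \<rho>)" .
    have "cis \<theta> - cis (- \<theta>) = 2 * \<i> * s" by (simp add: complex_eq_iff s_def)
    then have "v - cis (- \<theta>) = (v - cis \<theta>) + 2 * \<i> * s" by (simp add: algebra_simps)
    also have "cmod \<dots> \<le> \<rho> + 2 * s"
      by (rule order_trans[OF norm_triangle_ineq]) (use v s in \<open>simp add: norm_mult\<close>)
    finally have "cmod (v - cis (- \<theta>)) \<le> 9 / 4 * s" using \<rho> by (simp add: s_def)
    then have "cmod ((v - cis \<theta>) * (v - cis (- \<theta>)) / v ^ 3) \<le> (\<rho> * (9 / 4 * s)) / (3 / 4) ^ 3"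
      unfolding norm_divide norm_mult norm_power
      using v cv s \<open>\<rho> \<ge> 0\<close> by (intro frac_le mult_mono power_mono) auto
    also have "\<dots> = 16 / 3 * \<rho> * s" by (simp add: power3_eq_cube)
    finally show "cmod ((v - cis \<theta>) * (v - cis (- \<theta>)) / v ^ 3) \<le> 16 / 3 * \<rho> * s" .
  qed (use Z \<open>\<rho> \<ge> 0\<close> in \<open>auto simp: dist_norm norm_minus_commute\<close>)
  also have "\<dots> \<le> (16 / 3 * \<rho> * s) * \<rho>"
    using Z \<open>\<rho> \<ge> 0\<close> s by (intro mult_left_mono) auto
  finally have "\<bar>Im (Q Z - Q (cis \<theta>))\<bar> \<le> 16 / 3 * \<rho>\<^sup>2 * s"
    using abs_Im_le_cmod[of "Q Z - Q (cis \<theta>)"] by (simp add: power2_eq_square mult_ac)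
  moreover have "Im (Q (cis \<theta>)) = \<theta> - sin (2 * \<theta>) / 2"
  proof -
    have "Ln (cis \<theta>) = \<i> * \<theta>" using \<theta> by (simp add: cis_conv_exp Ln_exp)
    moreover have "1 / (2 * (cis \<theta>)\<^sup>2) = cis (- (2 * \<theta>)) / 2"
    proof -
      have "(cis \<theta>)\<^sup>2 = cis (2 * \<theta>)" by (simp add: Complex.DeMoivre)
      then have "1 / (2 * (cis \<theta>)\<^sup>2) = 1 / cis (2 * \<theta>) / 2" by simp
      then show ?thesis by (simp only: one_div_cis)
    qed
    moreover have "complex_of_real (2 * cos \<theta>) / cis \<theta> = 2 * cos \<theta> * cis (- \<theta>)"
      unfolding one_div_cis[symmetric] by simp
    ultimately have "Q (cis \<theta>) = \<i> * \<theta> - cis (- (2 * \<theta>)) / 2 + 2 * cos \<theta> * cis (- \<theta>)"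
      unfolding Q_def by (simp only:)
    then show ?thesis by (simp add: sin_double)
  qed
  ultimately show ?thesis by (simp add: Q_def s_def)
qed

section \<open>Asymptotics for a single summand of variance 1/n\<close>

locale clt_summand = centered_distribution +
  fixes n :: nat
  assumes n_pos: "n \<ge> 1" and variance: "(\<integral>u. u\<^sup>2 \<partial>M) = 1 / n"
begin

text \<open>The delta of the overview, expressed through the law of \<open>X / sqrt n\<close>: a
  truncated third moment that is finite under a second moment alone.\<close>

definition lindeberg :: real where
  "lindeberg = n * (\<integral>u. u\<^sup>2 * min \<bar>u\<bar> 1 \<partial>M)"

lemma integrable_lindeberg: "integrable M (\<lambda>u. u\<^sup>2 * min \<bar>u\<bar> 1)"
  by (rule Bochner_Integration.integrable_bound[OF integrable_square])
     (auto simp: abs_mult mult_left_le)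

lemma lindeberg_nonneg: "lindeberg \<ge> 0"
  unfolding lindeberg_def by (intro mult_nonneg_nonneg Bochner_Integration.integral_nonneg) auto

text \<open>A pointwise lower bound for the integrand by \<open>a * u\<^sup>2 - a ^ 3\<close> shows
  that \<open>lindeberg\<close> is at least of order \<open>1 / sqrt n\<close>. Thus it is positive,
  and errors of order 1/n can be absorbed into it.\<close>

lemma inverse_n_le: "1 / n \<le> 8 * lindeberg\<^sup>2"
proof -
  \<comment> \<open>With \<open>a\<^sup>2 = 1 / (4 * n)\<close> the subtracted cube costs a quarter
    of the main term, leaving \<open>3 / 4 * a\<close>; squaring gives the factor 64/9, which is
    below 8.\<close>
  define a where "a = 1 / (2 * sqrt n)"
  have sn: "sqrt n \<ge> 1" using n_pos by simp
  have "1 / (2 * sqrt n) \<le> 1 / 1" using sn by (intro frac_le) linarith+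
  then have a: "0 < a" "a \<le> 1" using n_pos by (auto simp: a_def)
  have a2: "a\<^sup>2 = 1 / (4 * n)" using sn by (simp add: a_def power_divide power_mult_distrib)
  have pw: "a * u\<^sup>2 - a ^ 3 \<le> u\<^sup>2 * min \<bar>u\<bar> 1" for u :: real
  proof (cases "\<bar>u\<bar> \<ge> a")
    case True
    then have "a * u\<^sup>2 \<le> u\<^sup>2 * min \<bar>u\<bar> 1" using a
      by (subst mult.commute, intro mult_left_mono) auto
    then show ?thesis using a zero_le_power[of a 3] by linarith
  next
    case False
    then have "\<bar>u\<bar>\<^sup>2 \<le> a\<^sup>2" by (intro power_mono) auto
    then have "a * u\<^sup>2 \<le> a ^ 3" using a by (simp add: power3_eq_cube power2_eq_square mult_left_mono)
    moreover have "0 \<le> u\<^sup>2 * min \<bar>u\<bar> 1" by simp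
    ultimately show ?thesis by linarith
  qed
  have "a * (1 / n) - a ^ 3 = (\<integral>u. a * u\<^sup>2 - a ^ 3 \<partial>M)"
    using integrable_square prob_space by (simp add: variance)
  also have "\<dots> \<le> (\<integral>u. u\<^sup>2 * min \<bar>u\<bar> 1 \<partial>M)"
    by (intro integral_mono integrable_lindeberg pw) (use integrable_square in auto)
  finally have "n * (a * (1 / n) - a ^ 3) \<le> lindeberg"
    unfolding lindeberg_def by (intro mult_left_mono) auto
  also have "n * (a * (1 / n) - a ^ 3) = a * (3 / 4)"
    using n_pos a2 by (simp add: power3_eq_cube power2_eq_square field_simps)
  finally have "(a * (3 / 4))\<^sup>2 \<le> lindeberg\<^sup>2" using a by (intro power_mono) auto
  then have "9 / 64 * (1 / n) \<le> lindeberg\<^sup>2"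
    by (simp add: power_mult_distrib a2 power_divide)
  then show ?thesis using zero_le_power2[of lindeberg] by linarith
qed

context
  fixes Z :: complex
  assumes Z_lower: "3 / 4 \<le> cmod Z" and Z_upper: "cmod Z \<le> 5 / 4" and Im_Z: "Im Z > 0"
begin

text \<open>The exact remainder of the resolvent expansion after its quadratic term, scaled by
  \<open>n\<close>. Left as a quotient, the integrand grows only quadratically, so two moments
  suffice.\<close>

definition third :: complex where
  "third = n * (\<integral>u. of_real (u ^ 3) / (Z - of_real u) \<partial>M)"

lemma Z_nonzero: "Z \<noteq> 0"
  using Im_Z by auto

lemma Im_Z_le: "Im Z \<le> 5 / 4"
  using abs_Im_le_cmod[of Z] Z_upper by simp

text \<open>For \<open>\<bar>u\<bar> \<le> 1\<close> the distance of \<open>Z\<close> from the real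
  axis is enough. For larger \<open>u\<close>, \<open>\<bar>u\<bar> \<le> 5 / 4 + d\<close>, and
  both terms are at most multiples of \<open>d / Im Z\<close>.\<close>

lemma third_integrand_le:
  "cmod (of_real (u ^ 3) / (Z - of_real u)) \<le> 4 / Im Z * (u\<^sup>2 * min \<bar>u\<bar> 1)"
proof -
  define d where "d = cmod (Z - of_real u)"
  have d: "Im Z \<le> d" "d > 0"
    using Im_le_norm_diff_of_real[of Z u] Im_Z by (auto simp: d_def)
  have "\<bar>u\<bar> / d \<le> 4 / Im Z * min \<bar>u\<bar> 1"
  proof (cases "\<bar>u\<bar> \<le> 1")
    case True
    have "\<bar>u\<bar> / d \<le> \<bar>u\<bar> / Im Z" using d Im_Z by (intro divide_left_mono) auto
    also have "\<dots> \<le> 4 / Im Z * min \<bar>u\<bar> 1" using True Im_Z by (simp add: divide_right_mono)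
    finally show ?thesis .
  next
    case False
    have "\<bar>u\<bar> = cmod (Z - (Z - of_real u))" by simp
    also have "\<dots> \<le> cmod Z + d" unfolding d_def by (rule norm_triangle_ineq4)
    finally have "\<bar>u\<bar> \<le> 5 / 4 + d" using Z_upper by simp
    also have "\<dots> \<le> 4 / Im Z * d"
    proof -
      have "5 / 4 * 1 \<le> 5 / 4 * (d / Im Z)" using d Im_Z by (intro mult_left_mono) auto
      moreover have "d * 1 \<le> d * (5 / 4 / Im Z)" using d Im_Z Im_Z_le by (intro mult_left_mono) auto
      moreover have "d / Im Z \<ge> 0" using d Im_Z by simp
      ultimately show ?thesis by simp
    qed
    finally show ?thesis using False d by (simp add: divide_le_eq)
  qed
  then have "u\<^sup>2 * (\<bar>u\<bar> / d) \<le> u\<^sup>2 * (4 / Im Z * min \<bar>u\<bar> 1)" by (intro mult_left_mono) auto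
  moreover have "cmod (of_real (u ^ 3) / (Z - of_real u)) = u\<^sup>2 * (\<bar>u\<bar> / d)"
    by (simp add: norm_divide d_def power3_eq_cube power2_eq_square abs_mult norm_mult)
  ultimately show ?thesis by (simp add: mult_ac)
qed

lemma integrable_third: "complex_integrable M (\<lambda>u. of_real (u ^ 3) / (Z - of_real u))"
proof (rule Bochner_Integration.integrable_bound)
  show "integrable M (\<lambda>u. 4 / Im Z * (u\<^sup>2 * min \<bar>u\<bar> 1))"
    by (intro integrable_mult_right integrable_lindeberg)
  show "AE u in M. norm (complex_of_real (u ^ 3) / (Z - of_real u)) \<le> norm (4 / Im Z * (u\<^sup>2 * min \<bar>u\<bar> 1))"
    using order_trans[OF third_integrand_le abs_ge_self] by (intro AE_I2) (simp only: real_norm_def)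
qed measurable

lemma norm_third_le: "cmod third \<le> 4 * lindeberg / Im Z"
proof -
  have "cmod (\<integral>u. of_real (u ^ 3) / (Z - of_real u) \<partial>M) \<le> (\<integral>u. 4 / Im Z * (u\<^sup>2 * min \<bar>u\<bar> 1) \<partial>M)"
    by (rule order_trans[OF integral_norm_bound], rule integral_mono)
       (intro integrable_norm integrable_third integrable_mult_right integrable_lindeberg third_integrand_le)+
  then have "n * cmod (\<integral>u. of_real (u ^ 3) / (Z - of_real u) \<partial>M) \<le> n * (4 / Im Z * (\<integral>u. u\<^sup>2 * min \<bar>u\<bar> 1 \<partial>M))"
    by (intro mult_left_mono) auto
  then show ?thesis by (simp add: third_def norm_mult lindeberg_def mult_ac)
qed

definition deviation :: complex where
  "deviation = (1 + third) / (n * Z\<^sup>2)"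

lemma integral_square_of_real: "(\<integral>u. (complex_of_real u)\<^sup>2 \<partial>M) = 1 / n"
  using variance by (simp flip: of_real_power)

text \<open>Expand \<open>Z / (Z - u)\<close> to second order with exact remainder and integrate:
  centering removes the linear term, and the variance 1/n produces the 1 in the numerator of
  \<open>deviation\<close>.\<close>

lemma Z_over_F: "Z / F Z = 1 + deviation"
proof -
  have eq: "Z * (1 / (Z - of_real u))
      = 1 + of_real u / Z + (of_real u)\<^sup>2 / Z\<^sup>2 + of_real (u ^ 3) / (Z - of_real u) / Z\<^sup>2" for u
    using diff_of_real_nonzero[OF Im_Z, of u] Z_nonzero
    by (simp add: divide_simps) (simp add: algebra_simps power2_eq_square power3_eq_cube)
  have i1: "complex_integrable M (\<lambda>u. of_real u / Z)"
    by (intro integrable_divide integrable_of_real integrable_ident)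
  have i2: "complex_integrable M (\<lambda>u. (of_real u)\<^sup>2 / Z\<^sup>2)"
    using integrable_divide[OF integrable_of_real[OF integrable_square, where 'a = complex], of "Z\<^sup>2"] by simp
  have i3: "complex_integrable M (\<lambda>u. of_real (u ^ 3) / (Z - of_real u) / Z\<^sup>2)"
    by (intro integrable_divide integrable_third)
  have "Z / F Z = (\<integral>u. Z * (1 / (Z - of_real u)) \<partial>M)"
    unfolding integral_mult_right_zero integral_resolvent by simp
  also have "\<dots> = 1 + (\<integral>u. complex_of_real u \<partial>M) / Z + (\<integral>u. (complex_of_real u)\<^sup>2 \<partial>M) / Z\<^sup>2
      + (\<integral>u. of_real (u ^ 3) / (Z - of_real u) \<partial>M) / Z\<^sup>2"
    unfolding eq using i1 i2 i3
    by (simp only: Bochner_Integration.integral_add Bochner_Integration.integrable_add integral_divide_zero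
          integrable_const prob_space lebesgue_integral_const scaleR_one)
  also have "\<dots> = 1 + deviation"
    using n_pos unfolding integral_square_of_real deviation_def third_def
    by (simp add: expectation_zero add_divide_distrib)
  finally show ?thesis .
qed

context
  assumes small: "4 * lindeberg \<le> Im Z" "lindeberg \<le> 1 / 8"
begin

text \<open>These bounds make \<open>deviation\<close> a perturbation:
  \<open>4 * lindeberg \<le> Im Z\<close> gives \<open>cmod third \<le> 1\<close>, hence
  \<open>cmod deviation \<le> 4 / n\<close>, which is now at most 1/2.\<close>

lemma inverse_n_small: "1 / n \<le> 1 / 8" "1 / n \<le> lindeberg"
proof -
  have "lindeberg\<^sup>2 \<le> (1 / 8) * lindeberg" "lindeberg\<^sup>2 \<le> 1 / 64"
    using mult_right_mono[OF small(2) lindeberg_nonneg] power_mono[OF small(2) lindeberg_nonneg, of 2]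
    by (auto simp: power2_eq_square)
  then show "1 / n \<le> 1 / 8" "1 / n \<le> lindeberg" using inverse_n_le by auto
qed

lemma norm_third_le_1: "cmod third \<le> 1"
  using norm_third_le small Im_Z by (auto elim!: order_trans simp: divide_le_eq)

lemma norm_deviation_le: "cmod deviation \<le> 4 / n"
proof -
  have "cmod (1 + third) \<le> 2"
    using norm_triangle_ineq[of 1 third] norm_third_le_1 by simp
  moreover have "(3 / 4)\<^sup>2 \<le> (cmod Z)\<^sup>2" using Z_lower by (intro power_mono) auto
  ultimately have "cmod (1 + third) / (cmod Z)\<^sup>2 \<le> 2 / (3 / 4)\<^sup>2"
    by (intro frac_le) auto
  also have "\<dots> \<le> 4" by (simp add: power2_eq_square)
  finally have "cmod (1 + third) / (cmod Z)\<^sup>2 / n \<le> 4 / n" by (intro divide_right_mono) auto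
  then show ?thesis
    by (simp add: deviation_def norm_divide norm_mult norm_power mult.commute)
qed

lemma norm_deviation_le_half: "cmod deviation \<le> 1 / 2"
  using norm_deviation_le inverse_n_small(1) by simp

lemma norm_1_deviation_ge: "1 / 2 \<le> cmod (1 + deviation)"
  using norm_diff_ineq[of 1 deviation] norm_deviation_le_half by simp

lemma N_eq: "N Z = Z * deviation / (1 + deviation)"
proof -
  have nz: "1 + deviation \<noteq> 0" using norm_1_deviation_ge by auto
  have "F Z = Z / (1 + deviation)"
    using Z_over_F F_nonzero[OF Im_Z] nz by (simp add: field_simps)
  then show ?thesis using nz by (simp add: N_def field_simps)
qed

text \<open>Since \<open>n * Z * deviation = (1 + third) / Z\<close>, the leading term is
  \<open>1 / Z\<close>, and the subordination map is close to the Joukowski map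
  \<open>Z + 1 / Z\<close>. All errors come from \<open>third\<close> or are of order 1/n.\<close>

lemma subordination_inverse_approx:
  "cmod ((real n - 1) * N Z - 1 / Z) \<le> 31 * lindeberg / Im Z"
proof -
  have nz: "1 + deviation \<noteq> 0" using norm_1_deviation_ge by auto
  have P1: "of_nat n * (Z * deviation) = (1 + third) / Z"
    using n_pos Z_nonzero by (simp add: deviation_def field_simps power2_eq_square)
  have P2: "Z * deviation = (1 + third) / (n * Z)"
    using n_pos Z_nonzero by (simp add: deviation_def field_simps power2_eq_square)
  have "(real n - 1) * (Z * deviation) = of_nat n * (Z * deviation) - Z * deviation"
    by (simp add: left_diff_distrib)
  also have "\<dots> = (1 + third) / Z - (1 + third) / (n * Z)"
    unfolding P1 unfolding P2 ..
  finally have "(real n - 1) * (Z * deviation) = (1 + third) / Z - (1 + third) / (n * Z)" .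
  then have N: "(real n - 1) * N Z = ((1 + third) / Z - (1 + third) / (n * Z)) / (1 + deviation)"
    by (simp add: N_eq flip: mult.assoc)
  have "(real n - 1) * N Z - 1 / Z = (third - (1 + third) / n - deviation) / Z / (1 + deviation)"
    unfolding N using nz Z_nonzero n_pos by (simp add: divide_simps) (simp add: algebra_simps)
  then have "cmod ((real n - 1) * N Z - 1 / Z)
      = cmod (third - (1 + third) / n - deviation) / cmod Z / cmod (1 + deviation)"
    by (simp add: norm_divide norm_mult)
  also have "\<dots> \<le> (4 * lindeberg / Im Z + 6 / n) / (3 / 4) / (1 / 2)"
  proof (intro frac_le Z_lower norm_1_deviation_ge)
    have "cmod (third - (1 + third) / n - deviation) \<le> cmod third + cmod ((1 + third) / n) + cmod deviation"
      by (meson add_mono norm_triangle_ineq4 order_trans order_refl)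
    also have "cmod ((1 + third) / n) \<le> 2 / n"
      using norm_triangle_ineq[of 1 third] norm_third_le_1 by (simp add: norm_divide divide_right_mono)
    finally show "cmod (third - (1 + third) / n - deviation) \<le> 4 * lindeberg / Im Z + 6 / n"
      using norm_third_le norm_deviation_le by simp
  qed (use lindeberg_nonneg Im_Z in auto)
  \<comment> \<open>Here 1/n is replaced by \<open>5 / 4 * (lindeberg / Im Z)\<close>, and 8/3 times
    4 + 15/2 is below 31.\<close>
  also have "\<dots> \<le> 31 * lindeberg / Im Z"
  proof -
    have "lindeberg * (Im Z) \<le> lindeberg * (5 / 4)"
      using lindeberg_nonneg Im_Z_le by (intro mult_left_mono) auto
    then have "lindeberg \<le> 5 / 4 * (lindeberg / Im Z)"
      using Im_Z by (simp add: field_simps)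
    moreover have "lindeberg / Im Z \<ge> 0" using lindeberg_nonneg Im_Z by simp
    ultimately show ?thesis using inverse_n_small(2) by simp
  qed
  finally show ?thesis .
qed

text \<open>For small \<open>w\<close> this is the cubic Taylor bound. Otherwise
  \<open>\<bar>u\<bar> \<ge> 3 / 8\<close>, and since the argument is bounded every term is at most
  a multiple of \<open>u\<^sup>2\<close>; large jumps therefore need no truncation.\<close>

lemma Im_Ln_remainder_le:
  "\<bar>Im (Ln (1 - of_real u / Z) + of_real u / Z + (of_real u / Z)\<^sup>2 / 2)\<bar> \<le> 88 * (u\<^sup>2 * min \<bar>u\<bar> 1)"
proof -
  define w where "w = of_real u / Z"
  have wu: "cmod w * cmod Z = \<bar>u\<bar>"
    using Z_nonzero by (simp add: w_def norm_divide)
  have "cmod w * (3 / 4) \<le> cmod w * cmod Z" by (intro mult_left_mono Z_lower) auto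
  then have w1: "cmod w \<le> 4 / 3 * \<bar>u\<bar>" using wu by simp
  show ?thesis
  proof (cases "cmod w \<le> 1 / 2")
    case True
    have "cmod w * cmod Z \<le> 1 / 2 * (5 / 4)" by (intro mult_mono True Z_upper) auto
    then have u1: "\<bar>u\<bar> \<le> 1" using wu by simp
    have "\<bar>Im (Ln (1 - w) + w + w\<^sup>2 / 2)\<bar> \<le> cmod (Ln (1 - w) + w + w\<^sup>2 / 2)" by (rule abs_Im_le_cmod)
    also have "\<dots> \<le> 2 * cmod w ^ 3" by (rule norm_Ln_cubic_remainder_le[OF True])
    also have "\<dots> \<le> 2 * (4 / 3 * \<bar>u\<bar>) ^ 3" by (intro mult_left_mono power_mono w1) auto
    also have "\<dots> = 128 / 27 * (u\<^sup>2 * \<bar>u\<bar>)" by (simp add: power3_eq_cube power2_eq_square)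
    also have "\<dots> \<le> 88 * (u\<^sup>2 * min \<bar>u\<bar> 1)" using u1 by (simp add: min_def mult_right_mono)
    finally show ?thesis by (simp add: w_def)
  next
    case False
    have "1 / 2 * (3 / 4) \<le> cmod w * cmod Z" using False by (intro mult_mono Z_lower) auto
    then have u1: "3 / 8 \<le> \<bar>u\<bar>" using wu by simp
    have u2: "3 / 8 * \<bar>u\<bar> \<le> u\<^sup>2" "9 / 64 \<le> u\<^sup>2"
      using mult_right_mono[OF u1 abs_ge_zero, of u] power_mono[OF u1, of 2] by (auto simp: power2_eq_square)
    have "\<bar>Im (Ln (1 - w) + w + w\<^sup>2 / 2)\<bar> \<le> \<bar>Im (Ln (1 - w))\<bar> + \<bar>Im w\<bar> + \<bar>Im (w\<^sup>2 / 2)\<bar>"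
      by simp
    also have "\<bar>Im (Ln (1 - w))\<bar> \<le> 4"
    proof -
      have "1 - w = (Z - of_real u) / Z" using Z_nonzero by (simp add: w_def field_simps)
      then have "1 - w \<noteq> 0" using diff_of_real_nonzero[OF Im_Z, of u] Z_nonzero by simp
      then show ?thesis using mpi_less_Im_Ln[of "1 - w"] Im_Ln_le_pi[of "1 - w"] pi_less_4 by auto
    qed
    also have "\<bar>Im w\<bar> \<le> cmod w" by (rule abs_Im_le_cmod)
    also have "\<bar>Im (w\<^sup>2 / 2)\<bar> \<le> cmod (w\<^sup>2 / 2)" by (rule abs_Im_le_cmod)
    also have "\<dots> = (cmod w)\<^sup>2 / 2" by (simp add: norm_divide norm_power)
    also have "\<dots> \<le> (4 / 3 * \<bar>u\<bar>)\<^sup>2 / 2" by (intro divide_right_mono power_mono w1) auto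
    \<comment> \<open>From \<open>u\<^sup>2 \<ge> 9 / 64\<close> the constant 4 costs 256/9, the
      linear term 32/9 and the quadratic term 8/9, in total less than 33; the later factor 8/3 gives
      88.\<close>
    finally have "\<bar>Im (Ln (1 - w) + w + w\<^sup>2 / 2)\<bar> \<le> 33 * u\<^sup>2"
      using w1 u2 by (simp add: power_mult_distrib power2_eq_square)
    also have "\<dots> \<le> 88 * (u\<^sup>2 * min \<bar>u\<bar> 1)"
    proof -
      have "u\<^sup>2 * (3 / 8) \<le> u\<^sup>2 * min \<bar>u\<bar> 1" using u1 by (intro mult_left_mono) auto
      then show ?thesis by linarith
    qed
    finally show ?thesis by (simp add: w_def)
  qed
qed

text \<open>Integrate the Taylor expansion of the argument: the linear term has mean zero, and the
  variance 1/n cancels the factor \<open>n\<close> in the quadratic term.\<close>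

lemma arg_potential_approx:
  "\<bar>n * arg_potential M Z - (n * Im (Ln Z) - Im (1 / (2 * Z\<^sup>2)))\<bar> \<le> 88 * lindeberg"
proof -
  let ?r = "\<lambda>u. Im (Ln (1 - of_real u / Z) + of_real u / Z + (of_real u / Z)\<^sup>2 / 2)"
  have Ln: "Ln (1 - of_real u / Z) = Ln (Z - of_real u) - Ln Z" for u
  proof -
    have "1 - of_real u / Z = (Z - of_real u) / Z" using Z_nonzero by (simp add: field_simps)
    also have "Ln \<dots> = Ln (Z - of_real u) - Ln Z" using Im_Z by (intro Ln_divide_upper) auto
    finally show ?thesis .
  qed
  have r: "?r u = Im (Ln (Z - of_real u)) - Im (Ln Z) + Im (of_real u / Z) + Im ((of_real u)\<^sup>2 / (2 * Z\<^sup>2))" for u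
    unfolding Ln plus_complex.sel minus_complex.sel by (simp add: power_divide mult.commute)
  have i1: "complex_integrable M (\<lambda>u. of_real u / Z)"
    by (intro integrable_divide integrable_of_real integrable_ident)
  have i2: "complex_integrable M (\<lambda>u. (of_real u)\<^sup>2 / (2 * Z\<^sup>2))"
    using integrable_divide[OF integrable_of_real[OF integrable_square, where 'a = complex], of "2 * Z\<^sup>2"] by simp
  have "(\<integral>u. ?r u \<partial>M) = arg_potential M Z - Im (Ln Z) + Im ((\<integral>u. complex_of_real u \<partial>M) / Z)
      + Im ((\<integral>u. (complex_of_real u)\<^sup>2 \<partial>M) / (2 * Z\<^sup>2))"
    unfolding r arg_potential_def
    using integrable_Im_Ln[OF Im_Z] integrable_Im[OF i1] integrable_Im[OF i2] integral_Im[OF i1] integral_Im[OF i2]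
    by (simp only: Bochner_Integration.integral_add Bochner_Integration.integral_diff
        Bochner_Integration.integrable_add Bochner_Integration.integrable_diff integral_divide_zero
        integrable_const prob_space lebesgue_integral_const scaleR_one)
  also have "\<dots> = arg_potential M Z - Im (Ln Z) + Im (1 / n / (2 * Z\<^sup>2))"
    unfolding integral_square_of_real by (simp add: expectation_zero)
  also have "Im (1 / n / (2 * Z\<^sup>2)) = Im (1 / (2 * Z\<^sup>2)) / n"
  proof -
    have "1 / n / (2 * Z\<^sup>2) = 1 / (2 * Z\<^sup>2) / of_nat n" by simp
    then show ?thesis by (simp only: Im_divide_of_nat)
  qed
  finally have R: "(\<integral>u. ?r u \<partial>M) = arg_potential M Z - Im (Ln Z) + Im (1 / (2 * Z\<^sup>2)) / n" .
  have *: "real n * A - (real n * L - I) = real n * R" if "R = A - L + I / real n" for R A L I :: real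
    using that n_pos by (simp add: field_simps)
  have eq: "n * arg_potential M Z - (n * Im (Ln Z) - Im (1 / (2 * Z\<^sup>2))) = n * (\<integral>u. ?r u \<partial>M)"
    by (rule *[OF R])
  have "\<bar>n * (\<integral>u. ?r u \<partial>M)\<bar> \<le> n * (\<integral>u. 88 * (u\<^sup>2 * min \<bar>u\<bar> 1) \<partial>M)"
  proof -
    have i: "integrable M ?r" unfolding r
      by (intro Bochner_Integration.integrable_add Bochner_Integration.integrable_diff integrable_Im_Ln Im_Z
          integrable_Im i1 i2 integrable_const)
    have "\<bar>\<integral>u. ?r u \<partial>M\<bar> \<le> (\<integral>u. 88 * (u\<^sup>2 * min \<bar>u\<bar> 1) \<partial>M)"
      by (rule order_trans[OF integral_abs_bound], rule integral_mono)
         (intro integrable_abs i integrable_mult_right integrable_lindeberg Im_Ln_remainder_le)+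
    then show ?thesis by (simp add: abs_mult mult_left_mono)
  qed
  also have "\<dots> = 88 * lindeberg" by (simp add: lindeberg_def)
  finally show ?thesis unfolding eq .
qed

lemma Im_Ln_F: "Im (Ln (F Z)) = Im (Ln Z) - Im (Ln (1 + deviation))"
proof -
  have "Im (F Z) > 0" using Im_F_ge[OF Im_Z] Im_Z by simp
  from Ln_divide_upper[OF this Im_Z] show ?thesis by (simp add: Z_over_F)
qed

text \<open>The quotient \<open>(z - Z) / Z\<close> equals
  \<open>(n - 1) * deviation / (1 + deviation)\<close> exactly. Keeping \<open>z - Z\<close> rather
  than its approximation \<open>1 / Z\<close> avoids the factor \<open>1 / Im Z\<close> of
  \<open>subordination_inverse_approx\<close> and leaves an error of order 1/n.\<close>

lemma Ln_deviation_approx: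
  assumes z: "z = subordination_inverse (real n - 1) Z" "cmod z \<le> 9 / 4"
  shows "cmod ((real n - 1) * Ln (1 + deviation) - (z - Z) / Z) \<le> 54 * lindeberg"
proof -
  have nz: "1 + deviation \<noteq> 0" using norm_1_deviation_ge by auto
  let ?t = "complex_of_real (real n - 1)"
  have t: "cmod ?t \<le> n" using n_pos by (simp only: norm_of_real)
  have m: "?t * deviation = (z - Z) / Z * (1 + deviation)"
    using nz Z_nonzero by (simp add: z(1) subordination_inverse_def N_eq)
  have eq: "?t * Ln (1 + deviation) - (z - Z) / Z = ?t * (Ln (1 + deviation) - deviation) + (z - Z) / Z * deviation"
    using m by (simp add: algebra_simps)
  have "cmod (?t * Ln (1 + deviation) - (z - Z) / Z) \<le> cmod ?t * cmod (Ln (1 + deviation) - deviation) + cmod ((z - Z) / Z) * cmod deviation"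
    unfolding eq by (rule order_trans[OF norm_triangle_ineq]) (simp only: norm_mult order_refl)
  also have "\<dots> \<le> n * (2 * (4 / n)\<^sup>2) + 14 / 3 * (4 / n)"
  proof (intro add_mono mult_mono t norm_deviation_le)
    have "cmod (Ln (1 + deviation) - deviation) \<le> (cmod deviation)\<^sup>2 / (1 - cmod deviation)"
      using norm_deviation_le_half by (intro Ln_approx_linear) auto
    also have "\<dots> \<le> (4 / n)\<^sup>2 / (1 / 2)"
      using norm_deviation_le_half norm_deviation_le by (intro frac_le power_mono) auto
    finally show "cmod (Ln (1 + deviation) - deviation) \<le> 2 * (4 / n)\<^sup>2" by simp
    have "cmod (z - Z) \<le> 7 / 2" using norm_triangle_ineq4[of z Z] z(2) Z_upper by simp
    then have "cmod (z - Z) / cmod Z \<le> (7 / 2) / (3 / 4)" using Z_lower by (intro frac_le) auto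
    then show "cmod ((z - Z) / Z) \<le> 14 / 3" by (simp add: norm_divide)
  qed auto
  also have "\<dots> \<le> 54 * (1 / n)" using n_pos by (simp add: power2_eq_square field_simps)
  also have "\<dots> \<le> 54 * lindeberg" by (intro mult_left_mono inverse_n_small) auto
  finally show ?thesis .
qed

text \<open>All but one of the \<open>n\<close> copies of \<open>Im (Ln Z)\<close> cancel, and the
  logarithms of \<open>1 + deviation\<close> contribute \<open>Im (x / Z)\<close>. The constant is
  88 + 54, plus 2 for discarding \<open>y\<close>.\<close>

lemma potential_approx:
  assumes z: "Complex x y = subordination_inverse (real n - 1) Z" "\<bar>x\<bar> \<le> 2" "0 < y" "y \<le> lindeberg"
  shows "\<bar>n * arg_potential M Z - (real n - 1) * Im (Ln (F Z)) - Im (Ln Z - 1 / (2 * Z\<^sup>2) + x / Z)\<bar>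
    \<le> 144 * lindeberg"
proof -
  let ?z = "Complex x y" and ?L = "(real n - 1) * Ln (1 + deviation)"
  have "cmod ?z \<le> 9 / 4"
  proof -
    have "cmod ?z \<le> \<bar>x\<bar> + \<bar>y\<bar>" using cmod_le[of ?z] by simp
    then show ?thesis using z(2-4) small(2) by linarith
  qed
  from Ln_deviation_approx[OF z(1) this]
  have "\<bar>Im (?L - (?z - Z) / Z)\<bar> \<le> 54 * lindeberg"
    using abs_Im_le_cmod order_trans by blast
  moreover have "Im ?L = (real n - 1) * Im (Ln (1 + deviation))" by simp
  moreover have "Im ((?z - Z) / Z) = Im (x / Z) + Im (\<i> * y / Z)"
  proof -
    have "(?z - Z) / Z = x / Z + \<i> * y / Z - 1"
      using Z_nonzero by (simp add: Complex_eq diff_divide_distrib add_divide_distrib)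
    then show ?thesis by simp
  qed
  moreover have "\<bar>Im (\<i> * y / Z)\<bar> \<le> 2 * lindeberg"
  proof -
    have "\<bar>Im (\<i> * y / Z)\<bar> \<le> cmod (\<i> * y / Z)" by (rule abs_Im_le_cmod)
    also have "\<dots> = y / cmod Z" using z by (simp add: norm_divide norm_mult)
    also have "\<dots> \<le> lindeberg / (3 / 4)" using z Z_lower by (intro frac_le) auto
    also have "\<dots> \<le> 2 * lindeberg" using lindeberg_nonneg by simp
    finally show ?thesis .
  qed
  moreover have "n * arg_potential M Z - (real n - 1) * Im (Ln (F Z)) - Im (Ln Z - 1 / (2 * Z\<^sup>2) + x / Z)
     = (n * arg_potential M Z - (n * Im (Ln Z) - Im (1 / (2 * Z\<^sup>2))))
       + ((real n - 1) * Im (Ln (1 + deviation)) - Im (x / Z))"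
    by (simp add: Im_Ln_F algebra_simps)
  ultimately show ?thesis using arg_potential_approx unfolding minus_complex.sel by linarith
qed

end

end

section \<open>Solving the subordination equation near the unit circle\<close>

lemma disc_bounds:
  assumes \<theta>: "0 < sin \<theta>" "200 * lindeberg \<le> sin \<theta> ^ 3"
    and Z: "cmod (Z - cis \<theta>) \<le> 43 * lindeberg / (sin \<theta>)\<^sup>2"
  shows "43 * lindeberg / (sin \<theta>)\<^sup>2 \<le> sin \<theta> / 4" "lindeberg \<le> 1 / 8"
    "3 / 4 \<le> cmod Z" "cmod Z \<le> 5 / 4" "3 / 4 * sin \<theta> \<le> Im Z" "0 < Im Z" "4 * lindeberg \<le> Im Z"
proof -
  define s where "s = sin \<theta>"
  have s: "0 < s" "s \<le> 1" using \<theta> by (auto simp: s_def)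
  have s3: "s ^ 3 \<le> s" using power_decreasing[of 1 3 s] s by simp
  \<comment> \<open>The product 43 * 4 = 172 is below the 200 in the hypothesis; this makes the
    radius at most a quarter of \<open>sin \<theta>\<close>.\<close>
  have "43 * lindeberg * 4 \<le> s * s\<^sup>2"
    using \<theta> lindeberg_nonneg by (simp add: s_def power3_eq_cube power2_eq_square)
  then show *: "43 * lindeberg / (sin \<theta>)\<^sup>2 \<le> sin \<theta> / 4"
    unfolding s_def[symmetric] using s by (simp add: field_simps)
  show "lindeberg \<le> 1 / 8" using \<theta>[folded s_def] s s3 by linarith
  have Zs: "cmod (Z - cis \<theta>) \<le> s / 4" using Z * by (simp add: s_def)
  show "3 / 4 \<le> cmod Z" "cmod Z \<le> 5 / 4"
    using norm_triangle_ineq2[of "cis \<theta>" Z] norm_triangle_ineq2[of Z "cis \<theta>"] Zs s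
    by (auto simp: norm_minus_commute)
  show Im: "3 / 4 * sin \<theta> \<le> Im Z"
    using abs_Im_le_cmod[of "Z - cis \<theta>"] Zs s by (auto simp: s_def)
  then show "0 < Im Z" "4 * lindeberg \<le> Im Z" using \<theta> s3 by (auto simp: s_def)
qed

text \<open>Since \<open>Z + 1 / Z - 2 * cos \<theta> = (Z - cis \<theta>) * D Z\<close>, the
  equation reads \<open>(Z - cis \<theta>) * D Z = \<i> * y - E Z\<close>, a fixed point problem for
  Brouwer. The right side is at most \<open>43 * lindeberg / s\<close>, and dividing by
  \<open>D\<close>, of modulus at least \<open>s\<close>, gives the radius.\<close>

lemma subordination_inverse_near_circle:
  assumes \<theta>: "0 < sin \<theta>" "200 * lindeberg \<le> sin \<theta> ^ 3" and y: "0 < y" "y \<le> lindeberg"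
  obtains Z where "cmod (Z - cis \<theta>) \<le> 43 * lindeberg / (sin \<theta>)\<^sup>2"
    "subordination_inverse (real n - 1) Z = Complex (2 * cos \<theta>) y"
proof -
  define s where "s = sin \<theta>"
  have s: "0 < s" "s \<le> 1" using \<theta> by (auto simp: s_def)
  define \<rho> where "\<rho> = 43 * lindeberg / s\<^sup>2"
  have "\<rho> \<ge> 0" using lindeberg_nonneg by (simp add: \<rho>_def)
  let ?B = "cball (cis \<theta>) \<rho>"
  have B: "\<rho> \<le> s / 4" "lindeberg \<le> 1 / 8" "3 / 4 \<le> cmod Z" "cmod Z \<le> 5 / 4" "3 / 4 * s \<le> Im Z" "0 < Im Z" "4 * lindeberg \<le> Im Z"
    if "Z \<in> ?B" for Z
    using disc_bounds[OF \<theta>, of Z] that by (auto simp: \<rho>_def s_def dist_norm norm_minus_commute)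
  define D where "D Z = 1 - 1 / (Z * cis \<theta>)" for Z
  define E where "E Z = (real n - 1) * N Z - 1 / Z" for Z
  have D: "s \<le> cmod (D Z)" if Z: "Z \<in> ?B" for Z
  proof -
    have "Z \<noteq> 0" using B(6)[OF Z] by auto
    \<comment> \<open>The left side vanishes at the other root \<open>cis (- \<theta>)\<close>,
      which is \<open>2 * s\<close> away from \<open>cis \<theta>\<close>; moving by at most
      \<open>s / 4\<close> keeps it away from 0.\<close>
    have "Z * cis \<theta> - 1 = 2 * \<i> * s * cis \<theta> + (Z - cis \<theta>) * cis \<theta>"
    proof -
      have "cis \<theta> - cis (- \<theta>) = 2 * \<i> * s" "cis (- \<theta>) * cis \<theta> = 1"
        by (auto simp: complex_eq_iff s_def cis_mult)
      then have "2 * \<i> * s * cis \<theta> = cis \<theta> * cis \<theta> - 1"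
        by (metis left_diff_distrib)
      then show ?thesis by (simp add: algebra_simps)
    qed
    then have "cmod (Z * cis \<theta> - 1) \<ge> cmod (2 * \<i> * s * cis \<theta>) - cmod ((Z - cis \<theta>) * cis \<theta>)"
      by (metis norm_diff_ineq)
    moreover have "cmod (2 * \<i> * s * cis \<theta>) = 2 * s" "cmod ((Z - cis \<theta>) * cis \<theta>) \<le> s / 4"
      using s Z B(1)[OF Z] by (auto simp: norm_mult dist_norm norm_minus_commute)
    ultimately have "7 / 4 * s \<le> cmod (Z * cis \<theta> - 1)" by simp
    then have "7 / 4 * s / (5 / 4) \<le> cmod (Z * cis \<theta> - 1) / cmod Z"
      using B(3,4)[OF Z] s by (intro frac_le) auto
    also have "\<dots> = cmod (D Z)"
      using \<open>Z \<noteq> 0\<close> by (simp add: D_def norm_mult norm_divide[symmetric] diff_divide_distrib) (simp add: norm_divide norm_mult divide_simps mult.commute)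
    finally show ?thesis using s by simp
  qed
  have E: "cmod (E Z) \<le> 42 * lindeberg / s" if Z: "Z \<in> ?B" for Z
  proof -
    have "cmod (E Z) \<le> 31 * lindeberg / Im Z"
      unfolding E_def using B[OF Z] by (intro subordination_inverse_approx)
    also have "\<dots> \<le> 31 * lindeberg / (3 / 4 * s)"
      using B[OF Z] s lindeberg_nonneg by (intro divide_left_mono) auto
    also have "\<dots> \<le> 42 * lindeberg / s"
      using s lindeberg_nonneg by (simp add: field_simps)
    finally show ?thesis .
  qed
  obtain Z where Z: "Z \<in> ?B" "cis \<theta> + (\<i> * y - E Z) / D Z = Z"
  proof (rule brouwer[of ?B "\<lambda>Z. cis \<theta> + (\<i> * y - E Z) / D Z"])
    show "continuous_on ?B (\<lambda>Z. cis \<theta> + (\<i> * y - E Z) / D Z)"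
      unfolding E_def D_def
    proof (intro continuous_intros ballI)
      show "continuous_on ?B N"
        by (rule holomorphic_on_imp_continuous_on, rule holomorphic_on_subset[OF N_holomorphic]) (use B(6) in auto)
    next
      fix Z assume "Z \<in> ?B"
      then show "1 - 1 / (Z * cis \<theta>) \<noteq> 0" using D[of Z] s by (auto simp: D_def)
    qed (use B(6) in fastforce)+
    show "(\<lambda>Z. cis \<theta> + (\<i> * y - E Z) / D Z) \<in> ?B \<rightarrow> ?B"
    proof (intro funcsetI)
      fix Z assume Z: "Z \<in> ?B"
      have "cmod (\<i> * y - E Z) \<le> y + 42 * lindeberg / s"
        using norm_triangle_ineq4[of "\<i> * y" "E Z"] E[OF Z] y by (simp add: norm_mult)
      also have "\<dots> \<le> 43 * lindeberg / s"
      proof -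
        have "lindeberg * s \<le> lindeberg" using s lindeberg_nonneg by (simp add: mult_left_le)
        then have "lindeberg \<le> lindeberg / s" using s by (simp add: field_simps)
        then show ?thesis using y by simp
      qed
      finally have "cmod ((\<i> * y - E Z) / D Z) \<le> (43 * lindeberg / s) / s"
        unfolding norm_divide using s D[OF Z] lindeberg_nonneg by (intro frac_le) auto
      then show "cis \<theta> + (\<i> * y - E Z) / D Z \<in> ?B"
        by (simp add: dist_norm \<rho>_def power2_eq_square)
    qed
  qed (use \<open>\<rho> \<ge> 0\<close> in auto)
  have "Z \<noteq> 0" "D Z \<noteq> 0" using B(6)[OF Z(1)] D[OF Z(1)] s by auto
  have e1: "(Z - cis \<theta>) * D Z = \<i> * y - E Z"
    using Z(2) \<open>D Z \<noteq> 0\<close> by (metis add_diff_cancel_left' nonzero_eq_divide_eq)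
  have e2: "(Z - cis \<theta>) * D Z = Z - cis \<theta> + 1 / Z - cis (- \<theta>)"
  proof -
    have "cis (- \<theta>) = 1 / cis \<theta>" by (rule one_div_cis[symmetric])
    then show ?thesis using \<open>Z \<noteq> 0\<close> by (simp add: D_def field_simps)
  qed
  have "Z + (real n - 1) * N Z = cis \<theta> + cis (- \<theta>) + \<i> * y"
    using trans[OF sym[OF e1] e2] by (simp add: E_def algebra_simps)
  also have "\<dots> = Complex (2 * cos \<theta>) y" by (simp add: complex_eq_iff)
  finally show ?thesis
    using that[of Z] Z(1) by (simp add: subordination_inverse_def \<rho>_def s_def dist_norm norm_minus_commute)
qed

text \<open>The error in \<open>Z\<close> enters squared, as a multiple of
  \<open>lindeberg\<^sup>2 / s ^ 3\<close>. The hypothesis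
  \<open>200 * lindeberg \<le> sin \<theta> ^ 3\<close> reduces this to
  \<open>56 * lindeberg\<close>, to which \<open>potential_approx\<close> adds 144.\<close>

lemma arg_potential_estimate:
  assumes conv: "is_free_convolution_power n M \<nu>"
    and \<theta>: "0 < \<theta>" "\<theta> < pi" "200 * lindeberg \<le> sin \<theta> ^ 3" and y: "0 < y" "y \<le> lindeberg"
  shows "\<bar>arg_potential \<nu> (Complex (2 * cos \<theta>) y) - (\<theta> - sin (2 * \<theta>) / 2)\<bar> \<le> 200 * lindeberg"
proof -
  define s where "s = sin \<theta>"
  have s: "0 < s" using \<theta> by (simp add: s_def sin_gt_zero)
  obtain Z where Z: "cmod (Z - cis \<theta>) \<le> 43 * lindeberg / s\<^sup>2"
    and sub: "subordination_inverse (real n - 1) Z = Complex (2 * cos \<theta>) y"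
    using subordination_inverse_near_circle[of \<theta> y] \<theta> y s unfolding s_def by blast
  note B = disc_bounds[OF s[unfolded s_def] \<theta>(3) Z[unfolded s_def]]
  have "Z \<in> subordination_domain (real n - 1)"
    using B(6) y by (simp add: subordination_domain_def sub)
  from arg_potential_subordination[OF conv n_pos this]
  have A: "arg_potential \<nu> (Complex (2 * cos \<theta>) y) = n * arg_potential M Z - (real n - 1) * Im (Ln (F Z))"
    by (simp add: sub)
  have 1: "\<bar>n * arg_potential M Z - (real n - 1) * Im (Ln (F Z)) - Im (Ln Z - 1 / (2 * Z\<^sup>2) + complex_of_real (2 * cos \<theta>) / Z)\<bar>
     \<le> 144 * lindeberg"
    by (rule potential_approx) (use B y sub in \<open>auto simp: abs_cos_le_one abs_mult\<close>)
  have "\<bar>Im (Ln Z - 1 / (2 * Z\<^sup>2) + complex_of_real (2 * cos \<theta>) / Z) - (\<theta> - sin (2 * \<theta>) / 2)\<bar>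
     \<le> 16 / 3 * (43 * lindeberg / s\<^sup>2)\<^sup>2 * sin \<theta>"
    by (rule semicircle_potential_bound[OF \<theta>(1,2) Z]) (use B(1) in \<open>simp add: s_def\<close>)
  also have "16 / 3 * (43 * lindeberg / s\<^sup>2)\<^sup>2 * sin \<theta> = 16 / 3 * 43\<^sup>2 * (lindeberg * (lindeberg / s ^ 3))"
    using s by (simp add: s_def[symmetric] power2_eq_square power3_eq_cube field_simps)
  also have "\<dots> \<le> 16 / 3 * 43\<^sup>2 * (lindeberg * (1 / 200))"
    using s \<theta>(3) lindeberg_nonneg by (intro mult_left_mono) (auto simp: s_def divide_le_eq)
  also have "\<dots> \<le> 56 * lindeberg" using lindeberg_nonneg by simp
  finally show ?thesis using 1 unfolding A by linarith
qed

end

section \<open>Normalization\<close>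

text \<open>
  \<^const>\<open>normalized_law\<close> is just the dilation by \<open>1 / sqrt n\<close>; it is also applied to \<open>\<mu>\<close>, giving
  the law of one summand \<open>X / sqrt n\<close>.
\<close>

lemma real_distribution_normalized_law:
  assumes "real_distribution \<mu>"
  shows "real_distribution (normalized_law n \<mu>)"
proof -
  interpret real_distribution \<mu> by fact
  show ?thesis
    unfolding normalized_law_def real_distribution_def real_distribution_axioms_def
    by (auto intro!: prob_space_distr)
qed

lemma recip_cauchy_transform_normalized_law:
  fixes z :: complex
  assumes "real_distribution \<mu>" "n \<ge> 1"
  shows "recip_cauchy_transform (normalized_law n \<mu>) z = recip_cauchy_transform \<mu> (sqrt n * z) / sqrt n"
proof -
  interpret real_distribution \<mu> by fact
  define r where "r = complex_of_real (sqrt n)"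
  have r: "r \<noteq> 0" using assms(2) by (simp add: r_def)
  have "cauchy_transform (normalized_law n \<mu>) z = (\<integral>u. 1 / (z - complex_of_real (u / sqrt n)) \<partial>\<mu>)"
    unfolding cauchy_transform_def normalized_law_def by (subst integral_distr) auto
  also have "\<dots> = (\<integral>u. r * (1 / (r * z - complex_of_real u)) \<partial>\<mu>)"
    using r by (intro Bochner_Integration.integral_cong refl)
      (simp add: r_def[symmetric] divide_simps algebra_simps)
  also have "\<dots> = r * cauchy_transform \<mu> (r * z)"
    unfolding cauchy_transform_def by (rule integral_mult_right_zero)
  finally show ?thesis by (simp add: recip_cauchy_transform_def r_def)
qed

text \<open>Conjugation by the dilation: the right inverse becomes \<open>H (r * z) / r\<close> on a
  cone of the same aperture. The normalization at infinity survives because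
  \<open>z \<mapsto> r * z\<close> tends to infinity inside the original cone.\<close>

lemma is_voiculescu_transform_normalized_law:
  fixes \<phi> :: "complex \<Rightarrow> complex"
  assumes \<mu>: "real_distribution \<mu>" and n: "n \<ge> 1" and V: "is_voiculescu_transform \<mu> \<alpha> \<beta> \<phi>"
  shows "is_voiculescu_transform (normalized_law n \<mu>) \<alpha> (\<beta> / sqrt n) (\<lambda>z. \<phi> (sqrt n * z) / sqrt n)"
proof -
  define s where "s = sqrt n"
  define r where "r = complex_of_real s"
  have s: "s > 0" using n by (simp add: s_def)
  then have r: "r \<noteq> 0" by (simp add: r_def)
  let ?C = "truncated_cone \<alpha> \<beta>" and ?C' = "truncated_cone \<alpha> (\<beta> / s)"
  define H where "H z = z + \<phi> z" for z
  have H: "H holomorphic_on ?C" "\<And>z. z \<in> ?C \<Longrightarrow> Im (H z) > 0 \<and> recip_cauchy_transform \<mu> (H z) = z"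
    "((\<lambda>z. H z / z) \<longlongrightarrow> 1) (inf at_infinity (principal ?C))"
    using V by (auto simp: is_voiculescu_transform_def is_recip_cauchy_inverse_def H_def[abs_def])
  have C: "r * z \<in> ?C" if "z \<in> ?C'" for z
    using that s by (auto simp: truncated_cone_def r_def abs_mult divide_less_eq mult.commute mult.left_commute)
  have eq: "z + \<phi> (r * z) / r = H (r * z) / r" for z
    using r by (simp add: H_def field_simps)
  have "(\<lambda>z. H (r * z) / r) holomorphic_on ?C'"
    using holomorphic_on_compose_gen[of "\<lambda>z. r * z" ?C' H ?C] H(1) C r
    by (auto simp: comp_def intro!: holomorphic_intros)
  moreover have "Im (H (r * z) / r) > 0 \<and> recip_cauchy_transform (normalized_law n \<mu>) (H (r * z) / r) = z"
    if "z \<in> ?C'" for z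
  proof
    show "Im (H (r * z) / r) > 0"
      using H(2)[OF C[OF that]] s by (simp add: r_def)
    have "recip_cauchy_transform (normalized_law n \<mu>) (H (r * z) / r) = recip_cauchy_transform \<mu> (H (r * z)) / r"
      using recip_cauchy_transform_normalized_law[OF \<mu> n, where z = "H (r * z) / r", folded s_def, folded r_def] r by simp
    then show "recip_cauchy_transform (normalized_law n \<mu>) (H (r * z) / r) = z"
      using H(2)[OF C[OF that]] r by simp
  qed
  moreover have "((\<lambda>z. H (r * z) / r / z) \<longlongrightarrow> 1) (inf at_infinity (principal ?C'))"
  proof -
    have "filterlim (\<lambda>z. r * z) at_infinity at_infinity"
      using r by (intro tendsto_mult_filterlim_at_infinity[OF tendsto_const]) (auto intro: filterlim_ident)
    then have "filterlim (\<lambda>z. r * z) at_infinity (inf at_infinity (principal ?C'))"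
      by (rule filterlim_mono[OF _ order_refl inf_le1])
    moreover have "filterlim (\<lambda>z. r * z) (principal ?C) (inf at_infinity (principal ?C'))"
      unfolding filterlim_principal using C by (auto simp: eventually_inf_principal)
    ultimately have "filterlim (\<lambda>z. r * z) (inf at_infinity (principal ?C)) (inf at_infinity (principal ?C'))"
      by (simp add: filterlim_inf)
    from filterlim_compose[OF H(3) this] show ?thesis by (simp add: divide_divide_eq_left)
  qed
  ultimately show ?thesis
    unfolding is_voiculescu_transform_def is_recip_cauchy_inverse_def s_def[symmetric] r_def[symmetric] eq by blast
qed

lemma is_free_convolution_power_normalized_law:
  assumes "is_free_convolution_power n \<mu> \<nu>" "n \<ge> 1"
  shows "is_free_convolution_power n (normalized_law n \<mu>) (normalized_law n \<nu>)"
proof -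
  have "\<forall>i\<in>{1..n}. real_distribution \<mu>"
    using assms unfolding is_free_convolution_power_def is_free_convolution_def by blast
  then have \<mu>: "real_distribution \<mu>" using assms(2) by auto
  obtain \<alpha> \<beta> \<phi> \<psi> where *: "\<alpha> > 0" "\<beta> > 0" "real_distribution \<nu>"
    and phi: "\<And>i. i \<in> {1..n} \<Longrightarrow> is_voiculescu_transform \<mu> \<alpha> \<beta> (\<phi> i)"
    and psi: "is_voiculescu_transform \<nu> \<alpha> \<beta> \<psi>"
    and psi_sum: "\<And>z. z \<in> truncated_cone \<alpha> \<beta> \<Longrightarrow> \<psi> z = (\<Sum>i\<in>{1..n}. \<phi> i z)"
    using assms(1) unfolding is_free_convolution_power_def is_free_convolution_def by blast
  let ?s = "sqrt n"
  have s: "?s > 0" using assms by simp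
  show ?thesis
    unfolding is_free_convolution_power_def is_free_convolution_def
  proof (intro conjI ballI exI)
    show "\<alpha> > 0" "\<beta> / ?s > 0" using * s by auto
    show "is_voiculescu_transform (normalized_law n \<mu>) \<alpha> (\<beta> / ?s) (\<lambda>z. \<phi> i (?s * z) / ?s)" if "i \<in> {1..n}" for i
      by (intro is_voiculescu_transform_normalized_law \<mu> assms phi that)
    show "is_voiculescu_transform (normalized_law n \<nu>) \<alpha> (\<beta> / ?s) (\<lambda>z. \<psi> (?s * z) / ?s)"
      by (intro is_voiculescu_transform_normalized_law * assms psi)
    fix z assume "z \<in> truncated_cone \<alpha> (\<beta> / ?s)"
    then have "?s * z \<in> truncated_cone \<alpha> \<beta>"
      using s by (auto simp: truncated_cone_def abs_mult divide_less_eq mult.commute mult.left_commute)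
    from psi_sum[OF this] show "\<psi> (?s * z) / ?s = (\<Sum>i\<in>{1..n}. \<phi> i (?s * z) / ?s)"
      by (simp add: sum_divide_distrib)
  qed (use * \<mu> in \<open>auto intro: real_distribution_normalized_law\<close>)
qed

lemma clt_summand_normalized_law:
  assumes \<mu>: "real_distribution \<mu>" and int: "integrable \<mu> (\<lambda>u. u\<^sup>2)"
    and mean: "(\<integral>u. u \<partial>\<mu>) = 0" and var: "(\<integral>u. u\<^sup>2 \<partial>\<mu>) = 1" and n: "n \<ge> 1"
  shows "clt_summand (normalized_law n \<mu>) n"
    and "clt_summand.lindeberg (normalized_law n \<mu>) n = (\<integral>u. u\<^sup>2 * min (\<bar>u\<bar> / sqrt n) 1 \<partial>\<mu>)"
proof -
  interpret real_distribution \<mu> by fact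
  interpret P: real_distribution "normalized_law n \<mu>"
    by (rule real_distribution_normalized_law[OF \<mu>])
  show P: "clt_summand (normalized_law n \<mu>) n"
  proof
    show "integrable (normalized_law n \<mu>) (\<lambda>u. u\<^sup>2)"
      unfolding normalized_law_def using int by (subst integrable_distr_eq) (auto simp: power_divide)
    show "(\<integral>u. u \<partial>normalized_law n \<mu>) = 0"
      unfolding normalized_law_def using mean by (subst integral_distr) auto
    show "(\<integral>u. u\<^sup>2 \<partial>normalized_law n \<mu>) = 1 / n"
      unfolding normalized_law_def using var by (subst integral_distr) (auto simp: power_divide)
  qed (use n in auto)
  have "(\<integral>u. u\<^sup>2 * min \<bar>u\<bar> 1 \<partial>normalized_law n \<mu>) = (\<integral>u. (u / sqrt n)\<^sup>2 * min \<bar>u / sqrt n\<bar> 1 \<partial>\<mu>)"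
    unfolding normalized_law_def by (subst integral_distr) auto
  also have "\<dots> = (\<integral>u. u\<^sup>2 * min (\<bar>u\<bar> / sqrt n) 1 / n \<partial>\<mu>)"
    by (intro Bochner_Integration.integral_cong refl) (simp add: power_divide)
  finally show "clt_summand.lindeberg (normalized_law n \<mu>) n = (\<integral>u. u\<^sup>2 * min (\<bar>u\<bar> / sqrt n) 1 \<partial>\<mu>)"
    using n by (simp add: clt_summand.lindeberg_def[OF P])
qed

section \<open>From argument potentials to the Kolmogorov distance\<close>

context real_distribution
begin

text \<open>As \<open>y\<close> decreases to 0, the argument of \<open>Complex x y - u\<close> tends
  to 0, pi/2 or pi according to the position of \<open>u\<close>. An atom at \<open>x\<close> gets
  half weight, so the limit lies between pi times the masses of the open and the closed
  half-line.\<close>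

lemma tails_of_arg_potential:
  assumes "d > 0" and A: "\<And>y. 0 < y \<Longrightarrow> y \<le> d \<Longrightarrow> \<bar>arg_potential M (Complex x y) - a\<bar> \<le> b"
  shows "pi * measure M {x<..} \<le> a + b" "a - b \<le> pi * measure M {x..}"
proof -
  define y where "y k = d / real (Suc k)" for k
  have y: "0 < y k" "y k \<le> d" for k using \<open>d > 0\<close> by (auto simp: y_def divide_le_eq mult_left_le)
  have y0: "y \<longlonglongrightarrow> 0" unfolding y_def by (rule LIMSEQ_Suc, rule lim_const_over_n)
  define f where "f u = (if u < x then 0 else if u = x then pi / 2 else pi)" for u :: real
  have fm [measurable]: "f \<in> borel_measurable M"
    unfolding f_def[abs_def] by measurable
  have lim: "(\<lambda>k. Im (Ln (Complex x (y k) - complex_of_real u))) \<longlonglongrightarrow> f u" for u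
  proof -
    have C: "(\<lambda>k. Complex (x - u) (y k)) \<longlonglongrightarrow> Complex (x - u) 0"
      by (intro tendsto_Complex tendsto_const y0)
    have eq: "Complex x (y k) - complex_of_real u = Complex (x - u) (y k)" for k
      by (simp add: complex_eq_iff)
    consider "u < x" | "u = x" | "x < u" by linarith
    then show ?thesis
    proof cases
      case 1
      then have "Complex (x - u) 0 \<notin> \<real>\<^sub>\<le>\<^sub>0" by (simp add: complex_nonpos_Reals_iff)
      from tendsto_Im[OF tendsto_Ln[OF C this]]
      have "(\<lambda>k. Im (Ln (Complex (x - u) (y k)))) \<longlonglongrightarrow> Im (Ln (complex_of_real (x - u)))"
        by (simp only: complex_of_real_def)
      moreover have "Im (Ln (complex_of_real (x - u))) = 0"
        using 1 by (subst Ln_of_real) auto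
      ultimately show ?thesis using 1 by (simp add: eq f_def)
    next
      case 2
      have "Ln (Complex 0 t) = ln t + \<i> * pi / 2" if "t > 0" for t
      proof -
        have "Complex 0 t = complex_of_real t * \<i>" by (simp add: complex_eq_iff)
        then show ?thesis using that by (simp add: Ln_times_of_real)
      qed
      then have "Im (Ln (Complex (x - u) (y k))) = pi / 2" for k using 2 y[of k] by simp
      then have "(\<lambda>k. Im (Ln (Complex (x - u) (y k)))) = (\<lambda>_. pi / 2)" by (rule ext)
      then show ?thesis unfolding eq using 2 by (simp only: f_def) simp
    next
      case 3
      \<comment> \<open>The limit point lies on the branch cut of \<open>Ln\<close>. Its negative
        does not, and the approach from above accounts for \<open>+ pi\<close>.\<close>
      have "Im (Ln (Complex (x - u) (y k))) = Im (Ln (- Complex (x - u) (y k))) + pi" for k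
        using Ln_minus[of "- Complex (x - u) (y k)"] y[of k] 3 by (simp add: complex_eq_iff)
      moreover have "- Complex (x - u) 0 \<notin> \<real>\<^sub>\<le>\<^sub>0" using 3 by (simp add: complex_nonpos_Reals_iff)
      from tendsto_Im[OF tendsto_Ln[OF tendsto_minus[OF C] this]]
      have "(\<lambda>k. Im (Ln (- Complex (x - u) (y k))) + pi) \<longlonglongrightarrow> Im (Ln (- Complex (x - u) 0)) + pi"
        by (rule tendsto_add[OF _ tendsto_const])
      moreover have "- Complex (x - u) 0 = complex_of_real (u - x)" by (simp add: complex_eq_iff)
      moreover have "Im (Ln (complex_of_real (u - x))) = 0"
        using 3 by (subst Ln_of_real) auto
      ultimately show ?thesis using 3 by (simp add: eq f_def)
    qed
  qed
  have "(\<lambda>k. arg_potential M (Complex x (y k))) \<longlonglongrightarrow> (\<integral>u. f u \<partial>M)"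
    unfolding arg_potential_def
  proof (rule integral_dominated_convergence[where w = "\<lambda>_. pi"])
    show "AE u in M. norm (Im (Ln (Complex x (y k) - complex_of_real u))) \<le> pi" for k
      using Im_Ln_bounds[of "Complex x (y k)"] y[of k]
      by (intro AE_I2) (auto simp: abs_le_iff less_imp_le intro: order_trans[of _ 0])
  qed (use lim in auto)
  then have "(\<lambda>k. \<bar>arg_potential M (Complex x (y k)) - a\<bar>) \<longlonglongrightarrow> \<bar>(\<integral>u. f u \<partial>M) - a\<bar>"
    by (intro tendsto_intros)
  then have "\<bar>(\<integral>u. f u \<partial>M) - a\<bar> \<le> b"
    by (rule LIMSEQ_le_const2) (use A y in auto)
  moreover have fi: "integrable M f"
    by (rule integrable_const_bound[of _ pi]) (auto simp: f_def)
  have ii: "integrable M (\<lambda>u. pi * indicator A u)" if "A \<in> sets M" for A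
    using that by (intro integrable_mult_right integrable_real_indicator) (auto simp: emeasure_eq_measure)
  have "(\<integral>u. pi * indicator {x<..} u \<partial>M) \<le> (\<integral>u. f u \<partial>M)"
    by (rule integral_mono[OF ii fi]) (auto simp: f_def split: split_indicator)
  then have "pi * measure M {x<..} \<le> (\<integral>u. f u \<partial>M)" by simp
  moreover have "(\<integral>u. f u \<partial>M) \<le> (\<integral>u. pi * indicator {x..} u \<partial>M)"
    by (rule integral_mono[OF fi ii]) (auto simp: f_def split: split_indicator)
  then have "(\<integral>u. f u \<partial>M) \<le> pi * measure M {x..}" by simp
  ultimately show "pi * measure M {x<..} \<le> a + b" "a - b \<le> pi * measure M {x..}" by auto
qed

end

section \<open>The semicircle law in the angle: for \<theta> in [0, pi],
  \<open>semicircle_tail\<close> is pi times its mass above \<open>2 * cos \<theta>\<close>\<close>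

definition semicircle_tail :: "real \<Rightarrow> real" where
  "semicircle_tail \<theta> = \<theta> - sin (2 * \<theta>) / 2"

lemma semicircle_tail_DERIV: "(semicircle_tail has_real_derivative 2 * (sin \<theta>)\<^sup>2) (at \<theta>)"
  unfolding semicircle_tail_def
  by (auto intro!: derivative_eq_intros simp: cos_double_sin diff_divide_distrib)

lemma semicircle_tail_reflect: "semicircle_tail (pi - \<theta>) = pi - semicircle_tail \<theta>"
  by (simp add: semicircle_tail_def sin_diff right_diff_distrib)

lemma semicircle_tail_mono_lipschitz:
  assumes "a \<le> b"
  shows "semicircle_tail a \<le> semicircle_tail b" "semicircle_tail b \<le> semicircle_tail a + 2 * (b - a)"
proof -
  have "\<exists>c. semicircle_tail b - semicircle_tail a = (b - a) * (2 * (sin c)\<^sup>2)"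
  proof (cases "a = b")
    case False
    then show ?thesis
      using MVT2[of a b semicircle_tail "\<lambda>\<theta>. 2 * (sin \<theta>)\<^sup>2"] semicircle_tail_DERIV assms by auto
  qed auto
  then obtain c where c: "semicircle_tail b - semicircle_tail a = (b - a) * (2 * (sin c)\<^sup>2)" by blast
  have "(sin c)\<^sup>2 \<le> 1" by (simp add: abs_square_le_1)
  then have "(b - a) * (2 * (sin c)\<^sup>2) \<le> (b - a) * 2"
    using assms by (intro mult_left_mono) auto
  moreover have "0 \<le> (b - a) * (2 * (sin c)\<^sup>2)"
    using assms by (intro mult_nonneg_nonneg) auto
  ultimately show "semicircle_tail a \<le> semicircle_tail b" "semicircle_tail b \<le> semicircle_tail a + 2 * (b - a)"
    using c by linarith+
qed

text \<open>The derivative \<open>2 * (sin c)\<^sup>2\<close> is at most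
  \<open>2 * \<theta>\<^sup>2\<close>. The mass near the edge is cubic in the angle, matching the
  cubic condition on \<open>sin \<theta>\<close> that excludes the edge.\<close>

lemma semicircle_tail_cubic:
  assumes "\<theta> > 0"
  shows "semicircle_tail \<theta> \<le> 2 * \<theta> ^ 3"
proof -
  obtain c where c: "0 < c" "c < \<theta>" "semicircle_tail \<theta> - semicircle_tail 0 = (\<theta> - 0) * (2 * (sin c)\<^sup>2)"
    using MVT2[of 0 \<theta> semicircle_tail "\<lambda>\<theta>. 2 * (sin \<theta>)\<^sup>2"] semicircle_tail_DERIV assms by auto
  have "\<bar>sin c\<bar> \<le> \<theta>" using abs_sin_x_le_abs_x[of c] c by simp
  then have "\<bar>sin c\<bar>\<^sup>2 \<le> \<theta>\<^sup>2" by (intro power_mono) auto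
  then have "\<theta> * (2 * (sin c)\<^sup>2) \<le> \<theta> * (2 * \<theta>\<^sup>2)" using assms by (intro mult_left_mono) auto
  then show ?thesis using c by (simp add: semicircle_tail_def power3_eq_cube power2_eq_square)
qed

lemma semicircle_density_nonneg: "semicircle_density x \<ge> 0"
  by (simp add: semicircle_density_def)

lemma semicircle_density_measurable [measurable]: "semicircle_density \<in> borel_measurable borel"
  unfolding semicircle_density_def[abs_def] by measurable

lemma semicircle_density_eq_0: "x \<notin> {-2<..<2} \<Longrightarrow> semicircle_density x = 0"
proof -
  assume "x \<notin> {-2<..<2}"
  then have "2 \<le> \<bar>x\<bar>" by auto
  then have "2\<^sup>2 \<le> \<bar>x\<bar>\<^sup>2" by (intro power_mono) auto
  then show ?thesis by (simp add: semicircle_density_def)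
qed

lemma nn_integral_semicircle_density:
  assumes "0 \<le> \<theta>" "\<theta> \<le> pi"
  shows "(\<integral>\<^sup>+x. ennreal (semicircle_density x) * indicator {-2..2 * cos \<theta>} x \<partial>lborel)
    = ennreal (1 - semicircle_tail \<theta> / pi)"
proof -
  define c where "c = 2 * cos \<theta>"
  \<comment> \<open>The explicit distribution function on [-2, 2]; at
    \<open>x = 2 * cos \<theta>\<close> the arccos is \<theta> and the root is
    \<open>2 * sin \<theta>\<close>.\<close>
  define W where "W x = 1 - (arccos (x / 2) - x / 4 * sqrt (4 - x\<^sup>2)) / pi" for x
  have c: "-2 \<le> c" "c \<le> 2" using cos_ge_minus_one[of \<theta>] cos_le_one[of \<theta>] by (auto simp: c_def)
  have "(semicircle_density has_integral (W c - W (-2))) {-2..c}"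
  \<comment> \<open>Derivatives are taken in the open interval only, since arccos and the root are
    singular at the edges.\<close>
  proof (rule fundamental_theorem_of_calculus_interior)
    show "continuous_on {-2..c} W"
      unfolding W_def using c by (intro continuous_intros) auto
    fix x assume "x \<in> {-2<..<c}"
    then have x: "-2 < x" "x < 2" using c by auto
    then have x2: "x\<^sup>2 < 4" using abs_square_less_1[of "x / 2"] by (simp add: power_divide abs_less_iff)
    define s where "s = sqrt (4 - x\<^sup>2)"
    have s: "s > 0" "s\<^sup>2 = 4 - x\<^sup>2" using x2 by (auto simp: s_def)
    have s'': "sqrt ((4 - x\<^sup>2) / 4) = s / 2" by (simp add: real_sqrt_divide s_def)
    have s': "sqrt (1 - (x / 2)\<^sup>2) = s / 2"
    proof -
      have "sqrt (1 - (x / 2)\<^sup>2) = sqrt ((4 - x\<^sup>2) / 4)" by (simp add: power_divide diff_divide_distrib)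
      then show ?thesis by (simp only: s'')
    qed
    have "(W has_real_derivative (- ((- (1 / 2) / (s / 2)) - (1 / 4 * s + x / 4 * (- (2 * x) / (2 * s)))) / pi)) (at x)"
      unfolding W_def using x x2 s
      by (auto intro!: derivative_eq_intros simp: s' s'' s_def[symmetric] field_simps)
    also have "- ((- (1 / 2) / (s / 2)) - (1 / 4 * s + x / 4 * (- (2 * x) / (2 * s)))) / pi = s / (2 * pi)"
    proof -
      have "(- ((- (1 / 2) / (s / 2)) - (1 / 4 * s + x / 4 * (- (2 * x) / (2 * s))))) = (4 + s\<^sup>2 - x\<^sup>2) / (4 * s)"
        using s(1) by (simp add: field_simps power2_eq_square)
      also have "\<dots> = (2 * s\<^sup>2) / (4 * s)" using s(2) by simp
      also have "\<dots> = s / 2" using s(1) by (simp add: power2_eq_square)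
      finally show ?thesis by (simp only: divide_divide_eq_left)
    qed
    also have "s / (2 * pi) = semicircle_density x"
      using x2 by (simp add: semicircle_density_def s_def max_def)
    finally show "(W has_vector_derivative semicircle_density x) (at x)"
      by (simp add: has_real_derivative_iff_has_vector_derivative)
  qed (use c in auto)
  from nn_integral_has_integral_lebesgue'[OF semicircle_density_nonneg this]
  have "(\<integral>\<^sup>+x. ennreal (semicircle_density x) * indicator {-2..c} x \<partial>lborel) = ennreal (W c - W (-2))" .
  moreover have "W (-2) = 0" by (simp add: W_def)
  moreover have "W c = 1 - semicircle_tail \<theta> / pi"
  proof -
    have "4 - c\<^sup>2 = (2 * sin \<theta>)\<^sup>2"
      by (simp add: c_def power_mult_distrib sin_squared_eq)
    then have "sqrt (4 - c\<^sup>2) = \<bar>2 * sin \<theta>\<bar>" by (simp only: real_sqrt_abs)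
    also have "\<dots> = 2 * sin \<theta>" using assms by (simp add: sin_ge_zero)
    finally have "sqrt (4 - c\<^sup>2) = 2 * sin \<theta>" .
    then show ?thesis using assms by (simp add: W_def c_def arccos_cos semicircle_tail_def sin_double)
  qed
  ultimately show ?thesis by (simp add: c_def)
qed

lemma real_distribution_semicircle: "real_distribution semicircle"
proof -
  have "prob_space semicircle"
  proof
    have "emeasure semicircle (space semicircle) = (\<integral>\<^sup>+x. ennreal (semicircle_density x) \<partial>lborel)"
      by (simp add: semicircle_def emeasure_density)
    also have "\<dots> = (\<integral>\<^sup>+x. ennreal (semicircle_density x) * indicator {-2..2 * cos 0} x \<partial>lborel)"
      using semicircle_density_eq_0 by (intro nn_integral_cong) (auto simp: indicator_def)
    also have "\<dots> = 1"
      by (subst nn_integral_semicircle_density) (auto simp: semicircle_tail_def)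
    finally show "emeasure semicircle (space semicircle) = 1" .
  qed
  then show ?thesis
    by (simp add: real_distribution_def real_distribution_axioms_def semicircle_def)
qed

lemma semicircle_tail_le_pi:
  assumes "\<theta> \<le> pi"
  shows "semicircle_tail \<theta> \<le> pi"
  using semicircle_tail_mono_lipschitz(1)[OF assms] by (simp add: semicircle_tail_def)

lemma distr_fun_semicircle:
  assumes "0 \<le> \<theta>" "\<theta> \<le> pi"
  shows "distr_fun semicircle (2 * cos \<theta>) = 1 - semicircle_tail \<theta> / pi"
proof -
  have "emeasure semicircle {..<2 * cos \<theta>}
      = (\<integral>\<^sup>+x. ennreal (semicircle_density x) * indicator {..<2 * cos \<theta>} x \<partial>lborel)"
    by (simp add: semicircle_def emeasure_density)
  also have "\<dots> = (\<integral>\<^sup>+x. ennreal (semicircle_density x) * indicator {-2..2 * cos \<theta>} x \<partial>lborel)"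
  proof (rule nn_integral_cong_AE)
    show "AE x in lborel. ennreal (semicircle_density x) * indicator {..<2 * cos \<theta>} x
        = ennreal (semicircle_density x) * indicator {-2..2 * cos \<theta>} x"
      using AE_lborel_singleton[of "2 * cos \<theta>"]
      by eventually_elim (auto simp: indicator_def semicircle_density_eq_0)
  qed
  also have "\<dots> = ennreal (1 - semicircle_tail \<theta> / pi)"
    by (rule nn_integral_semicircle_density[OF assms])
  finally show ?thesis
    using semicircle_tail_le_pi[OF assms(2)] by (simp add: distr_fun_def measure_def)
qed

section \<open>From tail bounds to a uniform bound on distribution functions\<close>

lemma (in real_distribution) distr_fun_mono: "x \<le> y \<Longrightarrow> distr_fun M x \<le> distr_fun M y"
  unfolding distr_fun_def by (intro finite_measure_mono) auto

lemma (in real_distribution) distr_fun_eq: "distr_fun M x = 1 - measure M {x..}"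
proof -
  have "{..<x} = space M - {x..}" by auto
  then show ?thesis unfolding distr_fun_def by (simp only:) (subst prob_compl, auto)
qed

text \<open>The complement of the open tail contains a possible atom at \<open>x\<close>, which the
  left-continuous convention counts only strictly to the right of \<open>x\<close>. This causes the
  small shift of the angle in the comparison below.\<close>

lemma (in real_distribution) distr_fun_ge:
  assumes "x < y"
  shows "1 - measure M {x<..} \<le> distr_fun M y"
proof -
  have "measure M {..x} = 1 - measure M {x<..}"
  proof -
    have "{..x} = space M - {x<..}" by auto
    then show ?thesis by (simp only:) (subst prob_compl, auto)
  qed
  moreover have "measure M {..x} \<le> distr_fun M y"
    unfolding distr_fun_def using assms by (intro finite_measure_mono) auto
  ultimately show ?thesis by simp
qed

text \<open>Tails compare directly for angles in [t, pi - t]. Beyond that range both distribution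
  functions are within O(\<delta>) of 0 or of 1, by monotonicity.\<close>

lemma (in real_distribution) semicircle_kolmogorov_bound:
  assumes \<delta>: "\<delta> > 0"
    and tails: "\<And>\<theta>. 0 < \<theta> \<Longrightarrow> \<theta> < pi \<Longrightarrow> 200 * \<delta> \<le> sin \<theta> ^ 3 \<Longrightarrow>
      pi * measure M {2 * cos \<theta><..} \<le> semicircle_tail \<theta> + 200 * \<delta> \<and>
      semicircle_tail \<theta> - 200 * \<delta> \<le> pi * measure M {2 * cos \<theta>..}"
  shows "\<bar>distr_fun M x - distr_fun semicircle x\<bar> \<le> 4000 * \<delta>"
proof -
  interpret S: real_distribution semicircle by (rule real_distribution_semicircle)
  let ?V = "distr_fun M" and ?w = "distr_fun semicircle" and ?g = semicircle_tail
  have range: "0 \<le> ?V x" "?V x \<le> 1" "0 \<le> ?w x" "?w x \<le> 1" for x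
    unfolding distr_fun_def by (auto intro: prob_le_1 S.prob_le_1)
  show ?thesis
  \<comment> \<open>For larger \<delta> the right side exceeds 1 and the bound is trivial; otherwise
    the angle \<open>t\<close> below is at most 1.\<close>
  proof (cases "\<delta> \<le> 1 / 1600")
    case False
    then show ?thesis using range[of x] by (auto simp: abs_le_iff)
  next
    case True
    \<comment> \<open>Chosen so that \<open>(t / 2) ^ 3 = 200 * \<delta>\<close>, while
      \<open>sin \<theta> \<ge> t / 2\<close> on [t, pi - t].\<close>
    define t where "t = root 3 (1600 * \<delta>)"
    have t3: "t ^ 3 = 1600 * \<delta>" using \<delta> by (simp add: t_def)
    have t: "0 < t" "t \<le> 1" using \<delta> True by (auto simp: t_def)
    have tpi: "t < pi / 2" using t pi_gt3 by simp
    have g: "?g t \<le> 3200 * \<delta>" using semicircle_tail_cubic[OF t(1)] t3 by simp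
    have sint: "t / 2 \<le> sin t"
    proof -
      obtain c where c: "0 < c" "c < t" "sin t - sin 0 = (t - 0) * cos c"
        using MVT2[of 0 t sin cos] t by auto
      \<comment> \<open>Here \<open>c < t \<le> 1 < pi / 3\<close>, so the slope of the sine stays
        above 1/2.\<close>
      have "cos (pi / 3) \<le> cos c" using c t pi_gt3 by (intro cos_monotone_0_pi_le) auto
      then have "t * (1 / 2) \<le> t * cos c" using t by (intro mult_left_mono) (auto simp: cos_60)
      then show ?thesis using c by simp
    qed
    have good: "200 * \<delta> \<le> sin \<theta> ^ 3" if "t \<le> \<theta>" "\<theta> \<le> pi - t" for \<theta>
    proof -
      have "sin t \<le> sin \<theta>"
      proof (cases "\<theta> \<le> pi / 2")
        case True
        then show ?thesis using that t by (intro sin_monotone_2pi_le) auto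
      next
        case False
        then have "sin t \<le> sin (pi - \<theta>)" using that t by (intro sin_monotone_2pi_le) auto
        then show ?thesis by simp
      qed
      then have "(t / 2) ^ 3 \<le> sin \<theta> ^ 3" using sint t by (intro power_mono) auto
      then show ?thesis using t3 by (simp add: power_divide)
    qed
    have up: "measure M {2 * cos \<theta><..} \<le> (?g \<theta> + 200 * \<delta>) / pi"
      and lo: "(?g \<theta> - 200 * \<delta>) / pi \<le> measure M {2 * cos \<theta>..}" if "t \<le> \<theta>" "\<theta> \<le> pi - t" for \<theta>
      using tails[OF _ _ good[OF that]] that t by (auto simp: divide_le_eq le_divide_eq mult.commute)
    have pi1: "a / pi \<le> a" if "a \<ge> 0" for a :: real
      using mult_left_mono[of 1 pi a] that pi_gt3 by (simp add: divide_le_eq)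
    have g0: "0 \<le> ?g t"
      using semicircle_tail_mono_lipschitz(1)[of 0 t] t by (simp add: semicircle_tail_def)
    note small = pi1[OF g0] pi1[of "200 * \<delta>"] pi1[of "2 * \<delta>"]
    note divs = add_divide_distrib diff_divide_distrib
    have w_max: "1 - 3200 * \<delta> \<le> ?w (2 * cos t)"
      using distr_fun_semicircle[of t] t tpi small g \<delta> by simp
    have w_min: "?w (2 * cos (pi - t)) \<le> 3200 * \<delta>"
      using distr_fun_semicircle[of "pi - t"] t tpi small g \<delta>
      unfolding semicircle_tail_reflect by (simp add: divs)
    have V_min: "?V (2 * cos (pi - t)) \<le> 3400 * \<delta>"
      using lo[of "pi - t"] t tpi small g \<delta>
      unfolding distr_fun_eq semicircle_tail_reflect by (simp add: divs)
    have V_max: "1 - 3400 * \<delta> \<le> ?V y" if "2 * cos t < y" for y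
      using distr_fun_ge[OF that] up[of t] t tpi small g \<delta> by (simp add: divs)
    consider "x \<le> 2 * cos (pi - t)" | "2 * cos t < x" | "2 * cos (pi - t) < x" "x \<le> 2 * cos t"
      by linarith
    then show ?thesis
    proof cases
      case 1
      then show ?thesis
        using distr_fun_mono[OF 1] S.distr_fun_mono[OF 1] V_min w_min range[of x] by (simp add: abs_le_iff)
    next
      case 2
      then show ?thesis
        using S.distr_fun_mono[of "2 * cos t" x] V_max[OF 2] w_max range[of x] by (simp add: abs_le_iff)
    next
      case 3
      define \<theta> where "\<theta> = arccos (x / 2)"
      have x: "-1 \<le> x / 2" "x / 2 \<le> 1"
        using 3 cos_ge_minus_one[of "pi - t"] cos_le_one[of t] by linarith+
      have xt: "x = 2 * cos \<theta>" using x by (simp add: \<theta>_def)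
      have "arccos (cos t) \<le> \<theta>" unfolding \<theta>_def
        using 3 x by (intro arccos_le_arccos) auto
      then have t1: "t \<le> \<theta>" using t tpi by (simp add: arccos_cos)
      have "\<theta> \<le> arccos (cos (pi - t))" unfolding \<theta>_def
        using 3 x by (intro arccos_le_arccos) auto
      then have t2: "\<theta> \<le> pi - t" using t tpi by (subst (asm) arccos_cos) auto
      have w: "?w x = 1 - ?g \<theta> / pi"
        unfolding xt using t1 t2 t by (intro distr_fun_semicircle) auto
      have "?V x \<le> ?w x + 200 * \<delta>"
        using lo[OF t1 t2] small \<delta> unfolding w unfolding xt distr_fun_eq by (simp add: divs)
      \<comment> \<open>The angle is increased by \<delta> to apply \<open>distr_fun_ge\<close> at a
        smaller abscissa, at a cost of \<open>2 * \<delta>\<close> by the Lipschitz bound. If it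
        leaves the good range, \<open>?w x\<close> is itself at most \<open>3202 * \<delta>\<close>
        and \<open>?V x \<ge> 0\<close> suffices.\<close>
      moreover have "?w x - 3202 * \<delta> \<le> ?V x"
      proof (cases "\<theta> + \<delta> \<le> pi - t")
        case True
        have "cos (\<theta> + \<delta>) < cos \<theta>"
          using True t1 t \<delta> by (intro cos_monotone_0_pi) auto
        then have "1 - measure M {2 * cos (\<theta> + \<delta>)<..} \<le> ?V x"
          unfolding xt by (intro distr_fun_ge) auto
        moreover have "measure M {2 * cos (\<theta> + \<delta>)<..} \<le> (?g (\<theta> + \<delta>) + 200 * \<delta>) / pi"
          using True t1 \<delta> by (intro up) auto
        moreover have "?g (\<theta> + \<delta>) / pi \<le> (?g \<theta> + 2 * \<delta>) / pi"
          using semicircle_tail_mono_lipschitz(2)[of \<theta> "\<theta> + \<delta>"] \<delta> by (intro divide_right_mono) auto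
        ultimately show ?thesis using small \<delta> unfolding w divs by simp
      next
        case False
        then have "?g (pi - t) \<le> ?g \<theta> + 2 * \<delta>"
          using semicircle_tail_mono_lipschitz(2)[OF t2] by simp
        then have "(pi - ?g t) / pi \<le> (?g \<theta> + 2 * \<delta>) / pi"
          unfolding semicircle_tail_reflect by (intro divide_right_mono) auto
        then show ?thesis using small g \<delta> range[of x] unfolding w divs by simp
      qed
      ultimately show ?thesis using \<delta> by (simp add: abs_le_iff)
    qed
  qed
qed

section \<open>The rate of convergence\<close>

text \<open>A Lindeberg form of the theorem that uses second moments only; both moment regimes are
  deduced from it.\<close>

lemma free_clt_lindeberg_bound:
  assumes \<mu>: "real_distribution \<mu>" and int: "integrable \<mu> (\<lambda>u. u\<^sup>2)"
    and mean: "(\<integral>u. u \<partial>\<mu>) = 0" and var: "(\<integral>u. u\<^sup>2 \<partial>\<mu>) = 1" and n: "n \<ge> 1"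
    and conv: "is_free_convolution_power n \<mu> \<nu>"
  shows "\<bar>distr_fun (normalized_law n \<nu>) x - distr_fun semicircle x\<bar>
    \<le> 4000 * (\<integral>u. u\<^sup>2 * min (\<bar>u\<bar> / sqrt n) 1 \<partial>\<mu>)"
proof -
  note summand = clt_summand_normalized_law[OF \<mu> int mean var n]
  interpret P: clt_summand "normalized_law n \<mu>" n by (rule summand)
  have conv': "is_free_convolution_power n (normalized_law n \<mu>) (normalized_law n \<nu>)"
    by (rule is_free_convolution_power_normalized_law[OF conv n])
  then interpret Y: real_distribution "normalized_law n \<nu>"
    by (simp add: is_free_convolution_power_def is_free_convolution_def)
  \<comment> \<open>Positivity leaves a nonempty range of heights
    \<open>0 < y \<le> lindeberg\<close> in which \<open>y\<close> can tend to 0.\<close>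
  have "P.lindeberg \<noteq> 0" using P.inverse_n_le n by (auto simp: divide_le_0_iff)
  then have pos: "P.lindeberg > 0" using P.lindeberg_nonneg by simp
  have "\<bar>distr_fun (normalized_law n \<nu>) x - distr_fun semicircle x\<bar> \<le> 4000 * P.lindeberg"
  proof (rule Y.semicircle_kolmogorov_bound[OF pos])
    fix \<theta> assume \<theta>: "0 < \<theta>" "\<theta> < pi" "200 * P.lindeberg \<le> sin \<theta> ^ 3"
    note est = P.arg_potential_estimate[OF conv' \<theta>, folded semicircle_tail_def]
    from Y.tails_of_arg_potential[OF pos est]
    show "pi * Y.prob {2 * cos \<theta><..} \<le> semicircle_tail \<theta> + 200 * P.lindeberg \<and>
      semicircle_tail \<theta> - 200 * P.lindeberg \<le> pi * Y.prob {2 * cos \<theta>..}" by blast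
  qed
  then show ?thesis by (simp only: summand(2))
qed

section \<open>Bounding the Lindeberg quantity by Lyapunov fractions\<close>

lemma integrable_powr_le:
  fixes p q :: real
  assumes \<mu>: "real_distribution \<mu>" and q: "integrable \<mu> (\<lambda>u. \<bar>u\<bar> powr q)" and p: "0 \<le> p" "p \<le> q"
  shows "integrable \<mu> (\<lambda>u. \<bar>u\<bar> powr p)"
proof -
  interpret real_distribution \<mu> by fact
  show ?thesis
  proof (rule Bochner_Integration.integrable_bound[of _ "\<lambda>u. 1 + \<bar>u\<bar> powr q"])
    show "AE u in \<mu>. norm (\<bar>u\<bar> powr p) \<le> norm (1 + \<bar>u\<bar> powr q)"
    proof (intro AE_I2)
      fix u :: real
      have "\<bar>u\<bar> powr p \<le> 1 + \<bar>u\<bar> powr q"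
      proof (cases "\<bar>u\<bar> \<le> 1")
        case True
        then have "\<bar>u\<bar> powr p \<le> 1" using p by (intro powr_le1) auto
        then show ?thesis by (simp add: add_increasing2)
      next
        case False
        then have "\<bar>u\<bar> powr p \<le> \<bar>u\<bar> powr q" using p by (intro powr_mono) auto
        then show ?thesis by simp
      qed
      then show "norm (\<bar>u\<bar> powr p) \<le> norm (1 + \<bar>u\<bar> powr q)" by simp
    qed
  qed (use q in auto)
qed

lemma lindeberg_le_lyapunov:
  assumes \<mu>: "real_distribution \<mu>" and int: "integrable \<mu> (\<lambda>u. \<bar>u\<bar> powr 3)"
    and int2: "integrable \<mu> (\<lambda>u. u\<^sup>2)" and n: "n \<ge> 1"
  shows "(\<integral>u. u\<^sup>2 * min (\<bar>u\<bar> / sqrt n) 1 \<partial>\<mu>) \<le> lyapunov_fraction \<mu> 3 n"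
proof -
  interpret real_distribution \<mu> by fact
  have "(\<integral>u. u\<^sup>2 * min (\<bar>u\<bar> / sqrt n) 1 \<partial>\<mu>) \<le> (\<integral>u. \<bar>u\<bar> powr 3 / sqrt n \<partial>\<mu>)"
  proof (rule integral_mono)
    show "integrable \<mu> (\<lambda>u. u\<^sup>2 * min (\<bar>u\<bar> / sqrt n) 1)"
      by (rule Bochner_Integration.integrable_bound[OF int2]) (auto simp: abs_mult mult_left_le)
    show "integrable \<mu> (\<lambda>u. \<bar>u\<bar> powr 3 / sqrt n)" using int by simp
    fix u :: real
    have "u\<^sup>2 * min (\<bar>u\<bar> / sqrt n) 1 \<le> u\<^sup>2 * (\<bar>u\<bar> / sqrt n)" by (intro mult_left_mono) auto
    also have "\<dots> = \<bar>u\<bar> ^ 3 / sqrt n" by (simp add: power3_eq_cube power2_eq_square abs_mult_self_eq)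
    also have "\<dots> = \<bar>u\<bar> powr 3 / sqrt n"
      using powr_realpow'[of "\<bar>u\<bar>" 3] by simp
    finally show "u\<^sup>2 * min (\<bar>u\<bar> / sqrt n) 1 \<le> \<bar>u\<bar> powr 3 / sqrt n" .
  qed
  then show ?thesis
    by (simp add: lyapunov_fraction_def abs_moment_def powr_half_sqrt)
qed

text \<open>Up to the level \<open>\<epsilon> * r\<close>, the factor
  \<open>\<bar>u\<bar> powr (3 - q)\<close> is at most its value at the level. Beyond it, the same
  holds for \<open>\<bar>u\<bar> powr (2 - q)\<close>, whose exponent is nonpositive, and
  \<open>\<epsilon> \<le> 1\<close> allows passing from the exponent \<open>2 - q\<close> of
  \<epsilon> to \<open>- q\<close>.\<close>

lemma truncation_pointwise:
  fixes q u \<epsilon> r :: real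
  assumes q: "2 \<le> q" "q \<le> 3" and \<epsilon>: "0 < \<epsilon>" "\<epsilon> \<le> 1" and r: "0 < r"
  shows "u\<^sup>2 * min (\<bar>u\<bar> / r) 1
    \<le> r powr (2 - q) * (\<epsilon> powr (3 - q) * \<bar>u\<bar> powr q
        + \<epsilon> powr (- q) * (indicator {u. \<bar>u\<bar> > \<epsilon> * r} u * \<bar>u\<bar> powr q))"
proof (cases "u = 0")
  case False
  then have u: "\<bar>u\<bar> > 0" by simp
  have u2: "u\<^sup>2 = \<bar>u\<bar> powr q * \<bar>u\<bar> powr (2 - q)"
    using u by (simp flip: powr_add)
  show ?thesis
  proof (cases "\<bar>u\<bar> \<le> \<epsilon> * r")
    case True
    have "u\<^sup>2 * min (\<bar>u\<bar> / r) 1 \<le> u\<^sup>2 * (\<bar>u\<bar> / r)" by (intro mult_left_mono) auto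
    also have "\<dots> = \<bar>u\<bar> powr q * (\<bar>u\<bar> powr (2 - q) * \<bar>u\<bar> powr 1) / r" using u by (simp add: u2)
    also have "\<bar>u\<bar> powr (2 - q) * \<bar>u\<bar> powr 1 = \<bar>u\<bar> powr (3 - q)"
      using powr_add[of "\<bar>u\<bar>" "2 - q" 1] by simp
    also have "\<bar>u\<bar> powr q * \<bar>u\<bar> powr (3 - q) / r \<le> \<bar>u\<bar> powr q * (\<epsilon> * r) powr (3 - q) / r"
      using True q r by (intro divide_right_mono mult_left_mono powr_mono2) auto
    also have "\<dots> = \<epsilon> powr (3 - q) * \<bar>u\<bar> powr q * (r powr (3 - q) / r powr 1)"
      using \<epsilon> r by (simp add: powr_mult)
    also have "r powr (3 - q) / r powr 1 = r powr (2 - q)"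
      using powr_diff[of r "3 - q" 1] by simp
    finally show ?thesis using True by (simp add: mult_ac)
  next
    case False
    have "u\<^sup>2 * min (\<bar>u\<bar> / r) 1 \<le> u\<^sup>2 * 1" by (intro mult_left_mono) auto
    also have "\<dots> = \<bar>u\<bar> powr q * \<bar>u\<bar> powr (2 - q)" using u2 by simp
    also have "\<dots> \<le> \<bar>u\<bar> powr q * (\<epsilon> * r) powr (2 - q)"
      using False q \<epsilon> r by (intro mult_left_mono powr_mono2') auto
    also have "\<dots> = \<bar>u\<bar> powr q * (\<epsilon> powr (2 - q) * r powr (2 - q))"
      using \<epsilon> r by (simp add: powr_mult)
    also have "\<dots> \<le> \<bar>u\<bar> powr q * (\<epsilon> powr (- q) * r powr (2 - q))"
      using \<epsilon> by (intro mult_left_mono mult_right_mono powr_mono') auto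
    also have "\<dots> \<le> r powr (2 - q) * (\<epsilon> powr (3 - q) * \<bar>u\<bar> powr q + \<epsilon> powr (- q) * \<bar>u\<bar> powr q)"
      by (simp add: algebra_simps)
    finally show ?thesis using False by simp
  qed
qed auto

text \<open>Integrate the pointwise truncation with \<open>r = sqrt n\<close> for each admissible
  \<epsilon>, divide by the Lyapunov fraction and take the infimum.\<close>

lemma lindeberg_le_eta1:
  assumes \<mu>: "real_distribution \<mu>" and q: "2 \<le> q" "q < 3" and int: "integrable \<mu> (\<lambda>u. \<bar>u\<bar> powr q)"
    and int2: "integrable \<mu> (\<lambda>u. u\<^sup>2)" and var: "(\<integral>u. u\<^sup>2 \<partial>\<mu>) = 1" and n: "n \<ge> 1"
  shows "(\<integral>u. u\<^sup>2 * min (\<bar>u\<bar> / sqrt n) 1 \<partial>\<mu>) \<le> eta1 \<mu> q n * lyapunov_fraction \<mu> q n"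
proof -
  interpret real_distribution \<mu> by fact
  define r where "r = sqrt n"
  have r: "r > 0" using n by (simp add: r_def)
  define L where "L = (\<integral>u. u\<^sup>2 * min (\<bar>u\<bar> / r) 1 \<partial>\<mu>)"
  define B where "B = abs_moment \<mu> q"
  \<comment> \<open>A vanishing moment would force \<open>u = 0\<close> almost everywhere,
    contradicting variance 1. This justifies the divisions by \<open>B\<close> and by the Lyapunov
    fraction.\<close>
  have "B \<noteq> 0"
  proof
    assume "B = 0"
    then have "AE u in \<mu>. \<bar>u\<bar> powr q = 0"
      unfolding B_def abs_moment_def by (subst (asm) integral_nonneg_eq_0_iff_AE[OF int]) auto
    then have "AE u in \<mu>. u\<^sup>2 = 0" by eventually_elim auto
    then have "(\<integral>u. u\<^sup>2 \<partial>\<mu>) = 0" by (rule integral_eq_zero_AE)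
    then show False using var by simp
  qed
  moreover have "B \<ge> 0" unfolding B_def abs_moment_def by (intro Bochner_Integration.integral_nonneg) auto
  ultimately have B: "B > 0" by simp
  have rn: "real n powr ((q - 2) / 2) = r powr (q - 2)"
    using n by (simp add: r_def powr_half_sqrt[symmetric] powr_powr)
  have lf: "lyapunov_fraction \<mu> q n = B * r powr (2 - q)"
    using powr_minus[of r "q - 2"] unfolding lyapunov_fraction_def rn B_def by (simp add: divide_inverse)
  then have lf0: "lyapunov_fraction \<mu> q n > 0" using B r by simp
  have "L / lyapunov_fraction \<mu> q n \<le> eta1 \<mu> q n"
    unfolding eta1_def Let_def
  proof (rule cINF_greatest)
    fix \<epsilon> :: real assume "\<epsilon> \<in> {0<..10 powr (- 1 / 2)}"
    moreover have "(10::real) powr (- 1 / 2) \<le> 10 powr 0" by (intro powr_mono) auto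
    ultimately have \<epsilon>: "0 < \<epsilon>" "\<epsilon> \<le> 1" by auto
    let ?ind = "indicator {u. \<bar>u\<bar> > \<epsilon> * r}"
    have i: "integrable \<mu> (\<lambda>u. ?ind u * \<bar>u\<bar> powr q)"
      using integrable_real_mult_indicator[OF _ int, of "{u. \<bar>u\<bar> > \<epsilon> * r}"] by (simp add: mult.commute)
    have "L \<le> (\<integral>u. r powr (2 - q) * (\<epsilon> powr (3 - q) * \<bar>u\<bar> powr q + \<epsilon> powr (- q) * (?ind u * \<bar>u\<bar> powr q)) \<partial>\<mu>)"
      unfolding L_def
    proof (rule integral_mono)
      show "integrable \<mu> (\<lambda>u. u\<^sup>2 * min (\<bar>u\<bar> / r) 1)"
        by (rule Bochner_Integration.integrable_bound[OF int2]) (use r in \<open>auto simp: abs_mult mult_left_le\<close>)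
    qed (use truncation_pointwise[OF q(1) less_imp_le[OF q(2)] \<epsilon> r] in
        \<open>auto intro!: integrable_mult_right Bochner_Integration.integrable_add int i\<close>)
    also have "\<dots> = r powr (2 - q) * (\<epsilon> powr (3 - q) * (\<integral>u. \<bar>u\<bar> powr q \<partial>\<mu>)
        + \<epsilon> powr (- q) * (\<integral>u. ?ind u * \<bar>u\<bar> powr q \<partial>\<mu>))"
      using integrable_mult_right[OF int] integrable_mult_right[OF i]
      by (simp only: integral_mult_right_zero Bochner_Integration.integral_add)
    also have "\<dots> = r powr (2 - q) * (\<epsilon> powr (3 - q) * B + \<epsilon> powr (- q) * tail_moment \<mu> q (\<epsilon> * r))"
      by (simp add: B_def abs_moment_def tail_moment_def set_lebesgue_integral_def)
    also have "\<dots> = (\<epsilon> powr (3 - q) + tail_moment \<mu> q (\<epsilon> * r) / B * \<epsilon> powr (- q)) * lyapunov_fraction \<mu> q n"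
      unfolding lf using B by (simp add: field_simps)
    finally show "L / lyapunov_fraction \<mu> q n \<le> \<epsilon> powr (3 - min q 3)
       + tail_moment \<mu> (min q 3) (\<epsilon> * sqrt (real n)) / abs_moment \<mu> (min q 3) * \<epsilon> powr - min q 3"
      using lf0 q by (simp add: divide_le_eq B_def r_def)
  qed simp
  then show ?thesis
    using lf0 by (simp add: divide_le_eq L_def r_def)
qed

theorem theorem2p1:
  "\<exists>c>0. \<forall>(q::real) (\<mu>::real measure) (n::nat) (\<nu>::real measure).
     q \<ge> 2 \<longrightarrow>
     real_distribution \<mu> \<longrightarrow>
     integrable \<mu> (\<lambda>u. \<bar>u\<bar> powr q) \<longrightarrow>
     (\<integral>u. u \<partial>\<mu>) = 0 \<longrightarrow>
     (\<integral>u. u\<^sup>2 \<partial>\<mu>) = 1 \<longrightarrow>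
     n \<ge> 1 \<longrightarrow>
     is_free_convolution_power n \<mu> \<nu> \<longrightarrow>
     (SUP x. \<bar>distr_fun (normalized_law n \<nu>) x - distr_fun semicircle x\<bar>)
       \<le> c * (if q < 3 then eta1 \<mu> q n * lyapunov_fraction \<mu> q n + 1 / real n
               else lyapunov_fraction \<mu> 3 n)"
proof (intro exI[of _ 4000] conjI allI impI)
  fix q :: real and \<mu> :: "real measure" and n :: nat and \<nu> :: "real measure"
  assume q: "q \<ge> 2" and \<mu>: "real_distribution \<mu>" and int: "integrable \<mu> (\<lambda>u. \<bar>u\<bar> powr q)"
    and mean: "(\<integral>u. u \<partial>\<mu>) = 0" and var: "(\<integral>u. u\<^sup>2 \<partial>\<mu>) = 1" and n: "n \<ge> 1"
    and conv: "is_free_convolution_power n \<mu> \<nu>"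
  have "\<bar>u\<bar> powr 2 = u\<^sup>2" for u :: real using powr_realpow'[of "\<bar>u\<bar>" 2] by simp
  with integrable_powr_le[OF \<mu> int, of 2] q have int2: "integrable \<mu> (\<lambda>u. u\<^sup>2)" by simp
  \<comment> \<open>In both regimes the Lindeberg quantity is dominated with factor 1, so the
    constant 4000 does not depend on \<open>q\<close>.\<close>
  have "(\<integral>u. u\<^sup>2 * min (\<bar>u\<bar> / sqrt n) 1 \<partial>\<mu>)
      \<le> (if q < 3 then eta1 \<mu> q n * lyapunov_fraction \<mu> q n + 1 / real n else lyapunov_fraction \<mu> 3 n)"
  proof (cases "q < 3")
    case True
    from lindeberg_le_eta1[OF \<mu> q True int int2 var n] show ?thesis using True by (simp add: add_increasing2)
  next
    case False
    then show ?thesis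
      using lindeberg_le_lyapunov[OF \<mu> integrable_powr_le[OF \<mu> int] int2 n] by simp
  qed
  then have "4000 * (\<integral>u. u\<^sup>2 * min (\<bar>u\<bar> / sqrt n) 1 \<partial>\<mu>)
      \<le> 4000 * (if q < 3 then eta1 \<mu> q n * lyapunov_fraction \<mu> q n + 1 / real n else lyapunov_fraction \<mu> 3 n)"
    by simp
  then show "(SUP x. \<bar>distr_fun (normalized_law n \<nu>) x - distr_fun semicircle x\<bar>)
       \<le> 4000 * (if q < 3 then eta1 \<mu> q n * lyapunov_fraction \<mu> q n + 1 / real n
               else lyapunov_fraction \<mu> 3 n)"
    by (intro cSUP_least order_trans[OF free_clt_lindeberg_bound[OF \<mu> int2 mean var n conv]]) auto
qed simp

end
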